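(* Let $S$ be a semidomain. The following are equivalent: (a) $S$ is a UFD; (b) $S[x]$ is a UFS; (c) $S[x^{\pm1}]$ is a UFS; (d) $S$ is an LFD; (e) $S[x]$ is an LFS; (f) $S[x^{\pm1}]$ is an LFS.
   Context: A semidomain is a subset $S$ of an integral domain $R$ containing $0$ and $1$ and closed under addition and multiplication; $S[x]$ (resp. $S[x^{\pm1}]$) is the semidomain of polynomials (resp. Laurent polynomials) in $R[x]$ (resp. $R[x^{\pm1}]$) with coefficients in $S$. For a semidomain $T$, $T^*=T\setminus\{0\}$ is a multiplicative monoid; an atom is a nonunit $a\in T^*$ such that $a=bc$ with $b,c\in T^*$ forces $b$ or $c$ to be a unit; $T$ is atomic if every nonunit of $T^*$ is a finite product of atoms. A factorization of $b$ is a formal product of atoms considered up to order and associates whose product is $b$ up to a unit; its length is the number of atoms with multiplicity. $T$ is a UFS (unique factorization semidomain) if it is atomic and every element of $T^*$ has exactly one factorization; $T$ is an LFS (length-factorial semidomain) if it is atomic and two distinct factorizations of the same element always have distinct lengths. A UFD (resp. LFD) is a semidomain that is an integral domain and a UFS (resp. LFS). *)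

theory Defs
  imports "HOL-Computational_Algebra.Polynomial" "HOL-Computational_Algebra.Formal_Laurent_Series"
    "HOL-Library.Multiset"
begin

definition semidomain :: "'a::idom set \<Rightarrow> bool" where
  "semidomain S \<longleftrightarrow> 0 \<in> S \<and> 1 \<in> S \<and> (\<forall>x\<in>S. \<forall>y\<in>S. x + y \<in> S \<and> x * y \<in> S)"

definition poly_semidomain :: "'a::idom set \<Rightarrow> 'a poly set" where
  "poly_semidomain S = {p. \<forall>n. coeff p n \<in> S}"

definition laurent_poly_semidomain :: "'a::idom set \<Rightarrow> 'a fls set" where
  "laurent_poly_semidomain S =
     {f. finite {n. fls_nth f n \<noteq> 0} \<and> (\<forall>n. fls_nth f n \<in> S)}"

definition sd_unit :: "'b::idom set \<Rightarrow> 'b \<Rightarrow> bool" where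
  "sd_unit T u \<longleftrightarrow> u \<in> T \<and> (\<exists>v\<in>T. u * v = 1)"

definition sd_atom :: "'b::idom set \<Rightarrow> 'b \<Rightarrow> bool" where
  "sd_atom T a \<longleftrightarrow> a \<in> T \<and> a \<noteq> 0 \<and> \<not> sd_unit T a \<and>
     (\<forall>b\<in>T - {0}. \<forall>c\<in>T - {0}. a = b * c \<longrightarrow> sd_unit T b \<or> sd_unit T c)"

definition sd_assoc :: "'b::idom set \<Rightarrow> 'b \<Rightarrow> 'b \<Rightarrow> bool" where
  "sd_assoc T a b \<longleftrightarrow> a \<in> T \<and> b \<in> T \<and> (\<exists>u. sd_unit T u \<and> a = u * b)"

definition sd_atomic :: "'b::idom set \<Rightarrow> bool" where
  "sd_atomic T \<longleftrightarrow> (\<forall>b\<in>T - {0}. \<not> sd_unit T b \<longrightarrow>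
     (\<exists>A. (\<forall>a\<in>#A. sd_atom T a) \<and> prod_mset A = b))"

text \<open>A factorization is a multiset of atoms considered up to associates; we identify
  an atom with its associate class.\<close>
definition sd_class :: "'b::idom set \<Rightarrow> 'b \<Rightarrow> 'b set" where
  "sd_class T a = {b. sd_assoc T b a}"

definition sd_factorization :: "'b::idom set \<Rightarrow> 'b multiset \<Rightarrow> 'b set multiset" where
  "sd_factorization T A = image_mset (sd_class T) A"

definition UFS :: "'b::idom set \<Rightarrow> bool" where
  "UFS T \<longleftrightarrow> sd_atomic T \<and>
     (\<forall>A B. (\<forall>a\<in>#A. sd_atom T a) \<longrightarrow> (\<forall>a\<in>#B. sd_atom T a) \<longrightarrow>
        sd_assoc T (prod_mset A) (prod_mset B) \<longrightarrow>
        sd_factorization T A = sd_factorization T B)"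

definition LFS :: "'b::idom set \<Rightarrow> bool" where
  "LFS T \<longleftrightarrow> sd_atomic T \<and>
     (\<forall>A B. (\<forall>a\<in>#A. sd_atom T a) \<longrightarrow> (\<forall>a\<in>#B. sd_atom T a) \<longrightarrow>
        sd_assoc T (prod_mset A) (prod_mset B) \<longrightarrow>
        sd_factorization T A \<noteq> sd_factorization T B \<longrightarrow> size A \<noteq> size B)"

text \<open>A semidomain is an integral domain iff it is closed under additive inverses
  (it is then a subring of the ambient domain).\<close>
definition sd_is_domain :: "'b::idom set \<Rightarrow> bool" where
  "sd_is_domain T \<longleftrightarrow> (\<forall>x\<in>T. - x \<in> T)"

definition UFD :: "'b::idom set \<Rightarrow> bool" where
  "UFD T \<longleftrightarrow> sd_is_domain T \<and> UFS T"

definition LFD :: "'b::idom set \<Rightarrow> bool" where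
  "LFD T \<longleftrightarrow> sd_is_domain T \<and> LFS T"

end

theory Submission
  imports Defs "HOL-Computational_Algebra.Polynomial_FPS"
begin

text \<open>
  If \<open>S\<close> is a UFD, Gauss' argument shows that \<open>S[x]\<close> is atomic with all atoms prime, and this passes to
  the Laurent polynomials since a nonzero Laurent polynomial is a power of \<open>x\<close> times a polynomial with
  nonzero constant coefficient.

  Conversely, let \<open>S[x]\<close> or \<open>S[x, 1/x]\<close> be length-factorial. If \<open>-1\<close> were not in \<open>S\<close>, the four factors in
  \<open>(x + 1) (x^4 + x^2 + 1) = (x^2 + x + 1) (x^3 + 1)\<close> would be atoms, giving two different
  factorizations of length two. So \<open>S\<close> is a domain, and it inherits length-factoriality because the
  divisors of constants are constants up to units.

  Finally, a length-factorial domain is factorial: its group of relations between atoms embeds into the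
  integers by the length difference, hence is cyclic. From a generating relation \<open>b * p = a * q\<close> one gets
  \<open>b * (p + q) = (a + b) * q\<close>, which cannot be a multiple of the generator.
\<close>

section \<open>Factorizations in multiplicative submonoids\<close>

text \<open>The degree-five identity comes from moving one factor around: over the ambient domain
  \<open>x^3 + 1 = (x + 1) (x^2 - x + 1)\<close> and
  \<open>x^4 + x^2 + 1 = (x^2 + x + 1) (x^2 - x + 1)\<close>, so the two products differ only in
  where \<open>x^2 - x + 1\<close> is attached. Its coefficient \<open>-1\<close> is exactly what is
  missing when the semidomain is not a domain.

  The step from length-factorial to factorial cannot be purely multiplicative: the commutative
  monoid generated by \<open>a\<close> and \<open>b\<close> with the single relation
  \<open>a^3 = b^2\<close> is length-factorial but not factorial. Addition has to enter, and it does
  so through the sum \<open>p + q\<close>.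

  Since \<open>S\<close> is a subset of a type, units, atoms and divisibility are relative to
  \<open>S\<close> and can differ from those of the ambient domain. Gauss' argument is therefore run
  inside \<open>S[x]\<close>: prime ideals extended coefficientwise and pseudo-division stand in for
  the field of fractions.\<close>

definition sd_dvd :: "'b::idom set \<Rightarrow> 'b \<Rightarrow> 'b \<Rightarrow> bool" where
  "sd_dvd T a b \<longleftrightarrow> (\<exists>c\<in>T. b = a * c)"

definition sd_prime :: "'b::idom set \<Rightarrow> 'b \<Rightarrow> bool" where
  "sd_prime T p \<longleftrightarrow> p \<in> T \<and> p \<noteq> 0 \<and> \<not> sd_unit T p \<and>
     (\<forall>a\<in>T. \<forall>b\<in>T. sd_dvd T p (a * b) \<longrightarrow> sd_dvd T p a \<or> sd_dvd T p b)"

text \<open>Factorizations only see multiplication, so one locale serves \<open>S\<close>,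
  \<open>S[x]\<close> and the Laurent polynomials alike. Cancellation comes from the ambient
  domain.\<close>

locale mult_submonoid =
  fixes T :: "'b::idom set"
  assumes one_closed [simp, intro]: "1 \<in> T"
    and mult_closed [simp, intro]: "a \<in> T \<Longrightarrow> b \<in> T \<Longrightarrow> a * b \<in> T"
begin

lemma prod_mset_closed: "(\<And>a. a \<in># A \<Longrightarrow> a \<in> T) \<Longrightarrow> prod_mset A \<in> T"
  by (induction A) auto

section \<open>Units and associates\<close>

lemma unit_one [simp, intro]: "sd_unit T 1"
  by (auto simp: sd_unit_def)

lemma unit_closed: "sd_unit T u \<Longrightarrow> u \<in> T"
  by (simp add: sd_unit_def)

lemma unit_nonzero: "sd_unit T u \<Longrightarrow> u \<noteq> 0"
  by (auto simp: sd_unit_def)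

lemma unit_inverse:
  assumes "sd_unit T u"
  obtains v where "sd_unit T v" "u * v = 1" "v * u = 1"
proof -
  from assms obtain v where "v \<in> T" "u \<in> T" "u * v = 1"
    by (auto simp: sd_unit_def)
  then show thesis
    by (intro that[of v]) (auto simp: sd_unit_def mult.commute)
qed

lemma unit_mult:
  assumes "sd_unit T u" "sd_unit T v"
  shows "sd_unit T (u * v)"
proof -
  obtain u' v' where "sd_unit T u'" "u * u' = 1" "sd_unit T v'" "v * v' = 1"
    using assms by (metis unit_inverse)
  moreover have "(u * v) * (u' * v') = (u * u') * (v * v')"
    by (simp add: mult_ac)
  ultimately show ?thesis
    using assms unfolding sd_unit_def by (metis mult_1 mult_closed)
qed

lemma unit_factor:
  assumes "sd_unit T (a * b)" "a \<in> T" "b \<in> T"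
  shows "sd_unit T a"
  using assms unfolding sd_unit_def by (metis mult.assoc mult_closed)

lemma assoc_refl [intro]: "a \<in> T \<Longrightarrow> sd_assoc T a a"
  unfolding sd_assoc_def by (metis mult_1 unit_one)

lemma assoc_sym: "sd_assoc T a b \<Longrightarrow> sd_assoc T b a"
  unfolding sd_assoc_def by (metis mult.assoc mult_1 unit_inverse)

lemma assoc_trans: "sd_assoc T a b \<Longrightarrow> sd_assoc T b c \<Longrightarrow> sd_assoc T a c"
  unfolding sd_assoc_def by (metis mult.assoc unit_mult)

lemma assoc_mult:
  assumes "sd_assoc T a b" "sd_assoc T c d"
  shows "sd_assoc T (a * c) (b * d)"
proof -
  obtain u v where "sd_unit T u" "a = u * b" "sd_unit T v" "c = v * d"
    using assms by (auto simp: sd_assoc_def)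
  then have "sd_unit T (u * v)" "a * c = (u * v) * (b * d)"
    by (auto simp: unit_mult mult_ac)
  then show ?thesis
    using assms unfolding sd_assoc_def by blast
qed

lemma assoc_cancel:
  assumes "sd_assoc T (a * c) (b * d)" "sd_assoc T a b" "a \<noteq> 0" "c \<in> T" "d \<in> T"
  shows "sd_assoc T c d"
proof -
  obtain u v where u: "sd_unit T u" "a = u * b" and v: "sd_unit T v" "a * c = v * (b * d)"
    using assms by (auto simp: sd_assoc_def)
  obtain u' where u': "sd_unit T u'" "u' * u = 1"
    using u unit_inverse by metis
  have "b \<noteq> 0" using u assms by auto
  moreover have "b * (u * c) = b * (v * d)"
    using u v by (simp add: mult_ac)
  ultimately have "u * c = v * d" by simp
  then have "c = (u' * v) * d"
    using u' by (metis mult.assoc mult_1)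
  then show ?thesis
    using assms u' v unit_mult unfolding sd_assoc_def by blast
qed

lemma unit_assoc_one: "sd_unit T u \<longleftrightarrow> sd_assoc T u 1"
  by (auto simp: sd_assoc_def unit_closed)

lemma unit_assoc: "sd_assoc T a b \<Longrightarrow> sd_unit T a \<longleftrightarrow> sd_unit T b"
  by (metis assoc_sym assoc_trans unit_assoc_one)

lemma class_eq_iff:
  assumes "a \<in> T"
  shows "sd_class T a = sd_class T b \<longleftrightarrow> sd_assoc T a b"
  using assms unfolding sd_class_def by (auto intro: assoc_trans assoc_sym)

section \<open>Atoms, divisibility and factorizations\<close>

lemma atomD:
  assumes "sd_atom T a"
  shows "a \<in> T" "a \<noteq> 0" "\<not> sd_unit T a"
  using assms by (auto simp: sd_atom_def)

lemma atom_factor: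
  "sd_atom T (b * c) \<Longrightarrow> b \<in> T \<Longrightarrow> c \<in> T \<Longrightarrow> sd_unit T b \<or> sd_unit T c"
  unfolding sd_atom_def by auto

lemma atomI:
  assumes "a \<in> T" "a \<noteq> 0" "\<not> sd_unit T a"
    and "\<And>b c. b \<in> T \<Longrightarrow> c \<in> T \<Longrightarrow> a = b * c \<Longrightarrow> sd_unit T b \<or> sd_unit T c"
  shows "sd_atom T a"
  using assms unfolding sd_atom_def by blast

lemma atom_assoc:
  assumes "sd_atom T a" "sd_assoc T a b"
  shows "sd_atom T b"
proof (rule atomI)
  obtain u where u: "sd_unit T u" "a = u * b"
    using assms by (auto simp: sd_assoc_def)
  show "b \<in> T" "b \<noteq> 0"
    using assms u atomD(2)[of a] by (auto simp: sd_assoc_def)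
  show "\<not> sd_unit T b"
    using assms unit_assoc atomD by blast
  fix c d assume cd: "c \<in> T" "d \<in> T" "b = c * d"
  have "sd_atom T ((u * c) * d)"
    using u cd assms by (simp add: mult.assoc)
  then have "sd_unit T (u * c) \<or> sd_unit T d"
    using atom_factor cd u unit_closed mult_closed by blast
  then show "sd_unit T c \<or> sd_unit T d"
    using unit_factor[of c u] cd u unit_closed by (auto simp: mult.commute)
qed

lemma atom_dvd_atom:
  assumes "sd_atom T a" "sd_atom T b" "sd_dvd T a b"
  shows "sd_assoc T a b"
proof -
  obtain c where c: "c \<in> T" "b = a * c"
    using assms by (auto simp: sd_dvd_def)
  have "sd_unit T c"
    using c assms atom_factor[of a c] atomD by blast
  then show ?thesis
    using c assms atomD assoc_sym[of b a] by (auto simp: sd_assoc_def mult.commute)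
qed

lemma dvd_assoc_right:
  assumes "sd_dvd T a b" "sd_assoc T b c"
  shows "sd_dvd T a c"
proof -
  obtain d where "d \<in> T" "b = a * d" using assms by (auto simp: sd_dvd_def)
  moreover obtain v where "sd_unit T v" "c = v * b"
    using assoc_sym[OF assms(2)] by (auto simp: sd_assoc_def)
  ultimately have "c = a * (v * d)" "v * d \<in> T"
    by (auto simp: mult_ac unit_closed)
  then show ?thesis by (auto simp: sd_dvd_def)
qed

lemma dvd_assoc_left:
  assumes "sd_dvd T a b" "sd_assoc T a c"
  shows "sd_dvd T c b"
proof -
  obtain d where "d \<in> T" "b = a * d" using assms by (auto simp: sd_dvd_def)
  moreover obtain v where "sd_unit T v" "a = v * c"
    using assms(2) by (auto simp: sd_assoc_def)
  ultimately have "b = c * (v * d)" "v * d \<in> T"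
    by (auto simp: mult_ac unit_closed)
  then show ?thesis by (auto simp: sd_dvd_def)
qed

lemma dvd_prod_mset:
  assumes "a \<in># A" "\<And>a. a \<in># A \<Longrightarrow> a \<in> T"
  shows "sd_dvd T a (prod_mset A)"
proof -
  obtain B where "A = add_mset a B" using assms(1) by (metis insert_DiffM)
  then show ?thesis
    using assms(2) prod_mset_closed[of B] by (auto simp: sd_dvd_def)
qed

lemma prod_atoms_closed: "\<forall>a\<in>#A. sd_atom T a \<Longrightarrow> prod_mset A \<in> T"
  by (intro prod_mset_closed) (auto simp: atomD)

lemma prod_atoms_nonzero: "\<forall>a\<in>#A. sd_atom T a \<Longrightarrow> prod_mset A \<noteq> 0"
  using atomD(2) by (auto simp: prod_mset_zero_iff)

lemma prod_atoms_unit: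
  assumes "\<forall>a\<in>#A. sd_atom T a" "sd_unit T (prod_mset A)"
  shows "A = {#}"
proof (cases A)
  case (add a B)
  then have "sd_unit T a"
    using assms unit_factor[of a "prod_mset B"] prod_atoms_closed[of B] atomD by auto
  then show ?thesis using add assms atomD by auto
qed

lemma atomic_factorization:
  assumes "sd_atomic T" "b \<in> T" "b \<noteq> 0"
  obtains A where "\<forall>a\<in>#A. sd_atom T a" "sd_assoc T b (prod_mset A)"
proof (cases "sd_unit T b")
  case True
  then show thesis using that[of "{#}"] unit_assoc_one by auto
next
  case False
  then show thesis using assms that unfolding sd_atomic_def
    by (metis DiffI assoc_refl singletonD)
qed

text \<open>Replaces equality of multisets of classes by a matching of associated atoms. A matching
  can be carried along a map between different types, as \<open>LFS_retract\<close> requires; the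
  classes cannot.\<close>

lemma factorization_eq_iff_rel_mset:
  assumes "\<forall>a\<in>#A. a \<in> T"
  shows "sd_factorization T A = sd_factorization T B \<longleftrightarrow> rel_mset (sd_assoc T) A B"
proof -
  have "sd_factorization T A = sd_factorization T B \<longleftrightarrow>
      rel_mset (\<lambda>a b. sd_class T a = sd_class T b) A B"
    unfolding sd_factorization_def multiset.rel_eq[symmetric] multiset.rel_map ..
  also have "\<dots> \<longleftrightarrow> rel_mset (sd_assoc T) A B"
    using assms class_eq_iff by (metis (mono_tags, lifting) multiset.rel_mono_strong)
  finally show ?thesis .
qed

text \<open>When neither factor is a unit, both have positive measure, so by additivity both
  measures are strictly smaller than that of the product and induction applies.\<close>

lemma atomic_if_measure:
  fixes \<mu> :: "'b \<Rightarrow> nat"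
  assumes add: "\<And>a b. a \<in> T \<Longrightarrow> b \<in> T \<Longrightarrow> a \<noteq> 0 \<Longrightarrow> b \<noteq> 0 \<Longrightarrow> \<mu> (a * b) = \<mu> a + \<mu> b"
    and pos: "\<And>a. a \<in> T \<Longrightarrow> a \<noteq> 0 \<Longrightarrow> \<mu> a = 0 \<Longrightarrow> sd_unit T a"
  shows "sd_atomic T"
proof -
  have "\<exists>A. (\<forall>a\<in>#A. sd_atom T a) \<and> prod_mset A = b"
    if "b \<in> T" "b \<noteq> 0" "\<not> sd_unit T b" for b
    using that
  proof (induction "\<mu> b" arbitrary: b rule: less_induct)
    case less
    show ?case
    proof (cases "sd_atom T b")
      case True
      then show ?thesis by (intro exI[of _ "{#b#}"]) auto
    next
      case False
      then obtain c d where cd: "c \<in> T" "d \<in> T" "b = c * d" "\<not> sd_unit T c" "\<not> sd_unit T d"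
        using less.prems atomI by blast
      have nz: "c \<noteq> 0" "d \<noteq> 0" using cd less.prems by auto
      have "\<mu> c < \<mu> b" "\<mu> d < \<mu> b"
        using add[of c d] pos[of c] pos[of d] cd nz by auto
      then obtain C D where "\<forall>a\<in>#C. sd_atom T a" "prod_mset C = c"
          "\<forall>a\<in>#D. sd_atom T a" "prod_mset D = d"
        using less.hyps cd nz by metis
      then show ?thesis
        using cd by (intro exI[of _ "C + D"]) auto
    qed
  qed
  then show ?thesis unfolding sd_atomic_def by blast
qed

section \<open>Primes and unique factorization\<close>

lemma prime_dvd_prod_mset:
  assumes "sd_prime T p" "\<forall>a\<in>#A. a \<in> T" "sd_dvd T p (prod_mset A)"
  shows "\<exists>a\<in>#A. sd_dvd T p a"
  using assms(2,3)
proof (induction A)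
  case empty
  then have "sd_unit T p"
    using assms(1) unfolding sd_dvd_def sd_unit_def sd_prime_def by auto
  then show ?case using assms(1) by (auto simp: sd_prime_def)
next
  case (add a A)
  then have "sd_dvd T p a \<or> sd_dvd T p (prod_mset A)"
    using assms(1) prod_mset_closed[of A] by (auto simp: sd_prime_def)
  then show ?case using add by auto
qed

text \<open>A prime atom taken from \<open>A\<close> divides some atom of \<open>B\<close>, hence is
  associated to it; cancelling the pair leaves a shorter instance.\<close>

lemma UFS_if_atoms_prime:
  assumes "sd_atomic T" and prime: "\<And>a. sd_atom T a \<Longrightarrow> sd_prime T a"
  shows "UFS T"
proof -
  have "sd_factorization T A = sd_factorization T B"
    if "\<forall>a\<in>#A. sd_atom T a" "\<forall>a\<in>#B. sd_atom T a" "sd_assoc T (prod_mset A) (prod_mset B)" for A B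
    using that
  proof (induction A arbitrary: B)
    case empty
    then have "sd_unit T (prod_mset B)"
      using assoc_sym unit_assoc_one by fastforce
    then show ?case using empty prod_atoms_unit by metis
  next
    case (add a A)
    have "sd_dvd T a (prod_mset B)"
      using add.prems by (intro dvd_assoc_right[OF dvd_prod_mset[of a "add_mset a A"]]) (auto simp: atomD)
    then obtain b where b: "b \<in># B" "sd_dvd T a b"
      using add.prems prime_dvd_prod_mset[OF prime, of a B] atomD by auto
    then have ab: "sd_assoc T a b"
      using add.prems atom_dvd_atom by simp
    obtain C where C: "B = add_mset b C" using b by (metis insert_DiffM)
    have "sd_assoc T (prod_mset A) (prod_mset C)"
      using add.prems C ab assoc_cancel[of a "prod_mset A" b "prod_mset C"]
        prod_atoms_closed atomD(2) by auto
    then have "sd_factorization T A = sd_factorization T C"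
      using add C by auto
    then show ?case
      using C ab class_eq_iff[of a b] add.prems
      by (simp add: sd_factorization_def sd_assoc_def)
  qed
  then show ?thesis using assms unfolding UFS_def by blast
qed

text \<open>If \<open>a * b = p * c\<close>, then joining factorizations of \<open>a\<close> and
  \<open>b\<close> gives the same classes as \<open>p\<close> joined to a factorization of
  \<open>c\<close>, so the class of \<open>p\<close> occurs in one of them. Zero has no
  factorization and is treated apart.\<close>

lemma UFS_atom_prime:
  assumes "UFS T" "sd_atom T p"
  shows "sd_prime T p"
proof -
  have "sd_dvd T p a \<or> sd_dvd T p b"
    if ab: "a \<in> T" "b \<in> T" "sd_dvd T p (a * b)" for a b
  proof (cases "a = 0 \<or> b = 0")
    case True
    then show ?thesis
    proof (elim disjE)
      assume "a = 0"
      then have "a = p * a" by simp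
      then show ?thesis using ab unfolding sd_dvd_def by blast
    next
      assume "b = 0"
      then have "b = p * b" by simp
      then show ?thesis using ab unfolding sd_dvd_def by blast
    qed
  next
    case False
    have at: "sd_atomic T" using assms by (simp add: UFS_def)
    obtain c where c: "c \<in> T" "a * b = p * c" using ab by (auto simp: sd_dvd_def)
    have "c \<noteq> 0" using c False by auto
    obtain A where A: "\<forall>a\<in>#A. sd_atom T a" "sd_assoc T a (prod_mset A)"
      using atomic_factorization at ab False by metis
    obtain B where B: "\<forall>a\<in>#B. sd_atom T a" "sd_assoc T b (prod_mset B)"
      using atomic_factorization at ab False by metis
    obtain C where C: "\<forall>a\<in>#C. sd_atom T a" "sd_assoc T c (prod_mset C)"
      using atomic_factorization at c \<open>c \<noteq> 0\<close> by metis
    have "sd_assoc T (p * c) (prod_mset (add_mset p C))"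
      using assoc_mult[OF assoc_refl C(2)] assms(2) atomD by simp
    moreover have "sd_assoc T (p * c) (prod_mset (A + B))"
      using assoc_mult[OF A(2) B(2)] c by simp
    ultimately have "sd_assoc T (prod_mset (add_mset p C)) (prod_mset (A + B))"
      using assoc_sym assoc_trans by blast
    moreover have "\<forall>a\<in>#add_mset p C. sd_atom T a" "\<forall>a\<in>#A + B. sd_atom T a"
      using A B C assms by auto
    ultimately have "sd_factorization T (add_mset p C) = sd_factorization T (A + B)"
      using assms(1) unfolding UFS_def by blast
    then have "sd_class T p \<in># sd_factorization T (A + B)"
      by (metis image_mset_add_mset sd_factorization_def union_single_eq_member)
    then obtain q where q: "q \<in># A + B" "sd_class T p = sd_class T q"
      by (auto simp: sd_factorization_def)
    then have "sd_assoc T q p"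
      using class_eq_iff[of p q] assms(2) atomD(1) assoc_sym by auto
    then show ?thesis
      using q A B dvd_prod_mset[of q A] dvd_prod_mset[of q B] atomD(1) assoc_sym
        dvd_assoc_left dvd_assoc_right by (metis union_iff)
  qed
  then show ?thesis using assms by (auto simp: sd_prime_def atomD)
qed

end

lemma LFS_if_UFS: "UFS T \<Longrightarrow> LFS T"
  unfolding UFS_def LFS_def by blast

section \<open>Length-factorial domains are factorial\<close>

context mult_submonoid
begin

section \<open>The group of relations between atoms\<close>

definition atom_relation :: "'b multiset \<Rightarrow> 'b multiset \<Rightarrow> bool" where
  "atom_relation A B \<longleftrightarrow> (\<forall>a\<in>#A. sd_atom T a) \<and> (\<forall>b\<in>#B. sd_atom T b) \<and>
     sd_assoc T (prod_mset A) (prod_mset B)"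

text \<open>A vector in the free abelian group on classes of atoms; integer values make it possible
  to subtract relations.\<close>

definition exponent_diff :: "'b multiset \<Rightarrow> 'b multiset \<Rightarrow> 'b set \<Rightarrow> int" where
  "exponent_diff A B c =
     int (count (sd_factorization T A) c) - int (count (sd_factorization T B) c)"

text \<open>The kernel of the map from the free abelian group on classes of atoms to fractions
  modulo units. The second component is the sum of the exponents; keeping it next to the vector lets
  division with remainder act directly on an integer.\<close>

definition relation_group :: "(('b set \<Rightarrow> int) \<times> int) set" where
  "relation_group =
     {(exponent_diff A B, int (size A) - int (size B)) | A B. atom_relation A B}"

lemma relation_groupI:
  "atom_relation A B \<Longrightarrow> (exponent_diff A B, int (size A) - int (size B)) \<in> relation_group"
  unfolding relation_group_def by blast

lemma atom_relation_add:
  "atom_relation A B \<Longrightarrow> atom_relation C D \<Longrightarrow> atom_relation (A + C) (B + D)"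
  unfolding atom_relation_def using assoc_mult by auto

lemma exponent_diff_eq_0_iff:
  "exponent_diff A B = (\<lambda>_. 0) \<longleftrightarrow> sd_factorization T A = sd_factorization T B"
  by (auto simp: exponent_diff_def fun_eq_iff multiset_eq_iff)

lemma relation_group_zero: "(\<lambda>_. 0, 0) \<in> relation_group"
  using relation_groupI[of "{#}" "{#}"]
  by (simp add: atom_relation_def assoc_refl exponent_diff_eq_0_iff[THEN iffD2])

lemma relation_group_add:
  assumes "(g, l) \<in> relation_group" "(h, m) \<in> relation_group"
  shows "(\<lambda>c. g c + h c, l + m) \<in> relation_group"
proof -
  obtain A B C D where "atom_relation A B" "g = exponent_diff A B" "l = int (size A) - int (size B)"
    "atom_relation C D" "h = exponent_diff C D" "m = int (size C) - int (size D)"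
    using assms unfolding relation_group_def by blast
  moreover have "exponent_diff (A + C) (B + D) = (\<lambda>c. exponent_diff A B c + exponent_diff C D c)"
    by (simp add: exponent_diff_def fun_eq_iff sd_factorization_def)
  ultimately show ?thesis
    using relation_groupI[OF atom_relation_add, of A B C D] by (simp add: add_diff_add)
qed

lemma relation_group_uminus:
  assumes "(g, l) \<in> relation_group"
  shows "(\<lambda>c. - g c, - l) \<in> relation_group"
proof -
  obtain A B where "atom_relation A B" "g = exponent_diff A B" "l = int (size A) - int (size B)"
    using assms unfolding relation_group_def by blast
  moreover from this have "atom_relation B A"
    using assoc_sym by (auto simp: atom_relation_def)
  ultimately show ?thesis
    using relation_groupI[of B A]
    by (auto simp: exponent_diff_def fun_eq_iff elim!: back_subst[of "\<lambda>x. x \<in> relation_group"])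
qed

lemma relation_group_scale:
  assumes "(g, l) \<in> relation_group"
  shows "(\<lambda>c. k * g c, k * l) \<in> relation_group"
proof -
  have nat: "(\<lambda>c. int n * h c, int n * m) \<in> relation_group" if "(h, m) \<in> relation_group" for n h m
    using that
  proof (induction n)
    case 0
    then show ?case using relation_group_zero by simp
  next
    case (Suc n)
    then show ?case
      using relation_group_add[OF Suc.prems Suc.IH] by (simp add: algebra_simps)
  qed
  show ?thesis
  proof (cases "k \<ge> 0")
    case True
    then show ?thesis using nat[OF assms, of "nat k"] by simp
  next
    case False
    then show ?thesis using nat[OF relation_group_uminus[OF assms], of "nat (- k)"] by simp
  qed
qed

text \<open>Length factoriality means that a relation among atoms is determined by its length
  difference, so the group of relations embeds into the integers and is cyclic.\<close>
lemma LFS_relation_generator: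
  assumes "LFS T" "\<not> UFS T"
  obtains A B where "atom_relation A B" "sd_factorization T A \<noteq> sd_factorization T B"
    "\<And>C D. atom_relation C D \<Longrightarrow> \<exists>k. exponent_diff C D = (\<lambda>c. k * exponent_diff A B c)"
proof -
  have inj: "g = (\<lambda>_. 0)" if g: "(g, 0) \<in> relation_group" for g
  proof -
    obtain A B where AB: "atom_relation A B" "g = exponent_diff A B" "size A = size B"
      using g unfolding relation_group_def by auto
    then have "sd_factorization T A = sd_factorization T B"
      using assms(1) unfolding LFS_def atom_relation_def by blast
    then show ?thesis using AB exponent_diff_eq_0_iff by simp
  qed
  obtain A0 B0 where 0: "atom_relation A0 B0" "sd_factorization T A0 \<noteq> sd_factorization T B0"
    using assms unfolding UFS_def LFS_def atom_relation_def by blast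
  define l0 where "l0 = int (size A0) - int (size B0)"
  have "l0 \<noteq> 0"
    using inj[of "exponent_diff A0 B0"] relation_groupI[OF 0(1)] 0(2) exponent_diff_eq_0_iff
    by (auto simp: l0_def)
  \<comment> \<open>The sign makes the length difference positive, so that a least positive one
    exists.\<close>
  moreover have "(\<lambda>c. sgn l0 * exponent_diff A0 B0 c, \<bar>l0\<bar>) \<in> relation_group"
    using relation_group_scale[OF relation_groupI[OF 0(1)], of "sgn l0"]
    by (simp add: abs_sgn mult.commute flip: l0_def)
  ultimately have ex: "\<exists>d. d > 0 \<and> (\<exists>g. (g, int d) \<in> relation_group)"
    by (intro exI[of _ "nat \<bar>l0\<bar>"]) auto
  define d where "d = (LEAST d. d > 0 \<and> (\<exists>g. (g, int d) \<in> relation_group))"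
  have "d > 0" "\<exists>g. (g, int d) \<in> relation_group"
    using LeastI_ex[OF ex] unfolding d_def by auto
  have d_le: "d \<le> e" if "e > 0" "(g, int e) \<in> relation_group" for e g
    using that unfolding d_def by (intro Least_le) auto
  from \<open>\<exists>g. (g, int d) \<in> relation_group\<close> obtain A B
    where AB: "atom_relation A B" "int (size A) - int (size B) = int d"
    unfolding relation_group_def by auto
  show thesis
  proof (rule that)
    show "atom_relation A B" by fact
    show "sd_factorization T A \<noteq> sd_factorization T B"
    proof
      assume "sd_factorization T A = sd_factorization T B"
      then have "size A = size B" unfolding sd_factorization_def by (metis size_image_mset)
      then show False using AB \<open>d > 0\<close> by simp
    qed
    fix C D assume "atom_relation C D"
    define l where "l = int (size C) - int (size D)"
    \<comment> \<open>Division with remainder: subtracting \<open>k\<close> times the generator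
      leaves a relation whose length difference is smaller than \<open>d\<close>, hence 0 by
      minimality, hence the trivial relation by \<open>inj\<close>.\<close>
    define k where "k = l div int d"
    have "(\<lambda>c. exponent_diff C D c + - k * exponent_diff A B c, l + - k * int d) \<in> relation_group"
      using relation_group_add[OF relation_groupI[OF \<open>atom_relation C D\<close>]
          relation_group_scale[OF relation_groupI[OF AB(1)], of "- k"]] AB(2)
      by (simp add: l_def)
    moreover have mod: "l + - k * int d = int (nat (l mod int d))"
      using \<open>d > 0\<close> by (simp add: k_def minus_div_mult_eq_mod)
    ultimately have *: "(\<lambda>c. exponent_diff C D c + - k * exponent_diff A B c,
        int (nat (l mod int d))) \<in> relation_group" by simp
    have "nat (l mod int d) < d"
      using \<open>d > 0\<close> by (simp add: nat_less_iff)
    then have "nat (l mod int d) = 0"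
      using * d_le leD by blast
    then have "(\<lambda>c. exponent_diff C D c + - k * exponent_diff A B c) = (\<lambda>_. 0)"
      using * inj by simp
    then show "\<exists>k. exponent_diff C D = (\<lambda>c. k * exponent_diff A B c)"
      by (intro exI[of _ k]) (simp add: fun_eq_iff)
  qed
qed

text \<open>Associated atoms on opposite sides cancel without changing the exponent vector. After
  that, the side on which an atom stands determines the sign of its exponent.\<close>

lemma irredundant_relation:
  assumes "atom_relation A B"
  obtains A' B' where "atom_relation A' B'" "exponent_diff A' B' = exponent_diff A B"
    "\<And>a b. a \<in># A' \<Longrightarrow> b \<in># B' \<Longrightarrow> \<not> sd_assoc T a b"
proof -
  have "\<exists>A' B'. atom_relation A' B' \<and> exponent_diff A' B' = exponent_diff A B \<and>
      (\<forall>a\<in>#A'. \<forall>b\<in>#B'. \<not> sd_assoc T a b)"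
    using assms
  proof (induction "size A" arbitrary: A B rule: less_induct)
    case less
    show ?case
    proof (cases "\<forall>a\<in>#A. \<forall>b\<in>#B. \<not> sd_assoc T a b")
      case True
      then show ?thesis using less.prems by blast
    next
      case False
      then obtain a b where ab: "a \<in># A" "b \<in># B" "sd_assoc T a b" by blast
      obtain C D where CD: "A = add_mset a C" "B = add_mset b D"
        using ab by (metis insert_DiffM)
      have "sd_class T a = sd_class T b"
        using class_eq_iff[of a b] ab by (auto simp: sd_assoc_def)
      then have "exponent_diff C D = exponent_diff A B"
        by (simp add: CD exponent_diff_def fun_eq_iff sd_factorization_def)
      moreover have "atom_relation C D"
        using less.prems ab assoc_cancel[of a "prod_mset C" b "prod_mset D"] prod_atoms_closed atomD(2)
        by (auto simp: atom_relation_def CD)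
      ultimately show ?thesis using less.hyps[of C D] CD by simp
    qed
  qed
  then show thesis using that by blast
qed

lemma count_factorization_pos_iff:
  assumes "\<forall>a\<in>#A. a \<in> T"
  shows "count (sd_factorization T A) (sd_class T b) > 0 \<longleftrightarrow> (\<exists>a\<in>#A. sd_assoc T a b)"
  using assms class_eq_iff unfolding sd_factorization_def count_greater_zero_iff
  by (metis (no_types, lifting) image_iff set_image_mset)

text \<open>Up to units, every divisor of an embedded element is itself embedded. Hence atoms stay
  atoms under \<open>\<iota>\<close>, and a factorization found in \<open>T\<close> is brought back
  by \<open>\<rho>\<close>. It is applied with constants embedded in \<open>S[x]\<close> and in the
  Laurent polynomials.\<close>

lemma LFS_retract:
  fixes S :: "'c::idom set" and \<iota> :: "'c \<Rightarrow> 'b" and \<rho> :: "'b \<Rightarrow> 'c"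
  assumes S: "mult_submonoid S" and LFS: "LFS T"
    and \<iota>: "\<And>a. a \<in> S \<Longrightarrow> \<iota> a \<in> T" "\<iota> 1 = 1" "\<And>a b. \<iota> (a * b) = \<iota> a * \<iota> b"
    and \<rho>: "\<And>a. a \<in> T \<Longrightarrow> \<rho> a \<in> S" "\<rho> 1 = 1" "\<And>a b. \<rho> (a * b) = \<rho> a * \<rho> b" "\<And>a. \<rho> (\<iota> a) = a"
    and divisor: "\<And>c t t'. c \<in> S \<Longrightarrow> c \<noteq> 0 \<Longrightarrow> t \<in> T \<Longrightarrow> t' \<in> T \<Longrightarrow> \<iota> c = t * t' \<Longrightarrow>
      sd_assoc T t (\<iota> (\<rho> t))"
  shows "LFS S"
proof -
  interpret S: mult_submonoid S by fact
  \<comment> \<open>Only multiplicativity of \<open>\<iota>\<close> is available, so idempotents are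
    used: \<open>\<iota> a = 0\<close> gives \<open>a * a = a\<close> after applying
    \<open>\<rho>\<close>, hence \<open>a = 1\<close>, against \<open>\<iota> 1 = 1\<close>.\<close>
  have \<iota>0: "\<iota> a \<noteq> 0" if "a \<noteq> 0" for a
  proof
    assume "\<iota> a = 0"
    then have "\<iota> (a * a) = \<iota> a" using \<iota>(3) by simp
    then have "a * a = a" using \<rho>(4) by metis
    with that have "a = 1" by simp
    then show False using \<open>\<iota> a = 0\<close> \<iota> by simp
  qed
  have unit: "sd_unit T (\<iota> u) \<longleftrightarrow> sd_unit S u" if "u \<in> S" for u
    using that \<iota> \<rho> unfolding sd_unit_def by metis
  have atom: "sd_atom T (\<iota> a) \<longleftrightarrow> sd_atom S a" if "a \<in> S" for a
  proof
    assume a: "sd_atom T (\<iota> a)"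
    show "sd_atom S a"
    proof (rule S.atomI)
      show "a \<in> S" by fact
      show "\<not> sd_unit S a" using a atomD unit that by blast
      show "a \<noteq> 0"
      proof
        assume "a = 0"
        then have "\<iota> a * \<iota> a = \<iota> a" using \<iota>(3)[of a a] by simp
        then have "\<iota> a = 0 \<or> \<iota> a = 1" by simp
        then show False using a atomD unit_one by metis
      qed
      fix b c assume "b \<in> S" "c \<in> S" "a = b * c"
      then show "sd_unit S b \<or> sd_unit S c"
        using a atom_factor[of "\<iota> b" "\<iota> c"] \<iota> unit by auto
    qed
  next
    assume a: "sd_atom S a"
    show "sd_atom T (\<iota> a)"
    proof (rule atomI)
      show "\<iota> a \<in> T" "\<not> sd_unit T (\<iota> a)" "\<iota> a \<noteq> 0"
        using a S.atomD \<iota> unit \<iota>0 by blast+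
      fix b c assume bc: "b \<in> T" "c \<in> T" "\<iota> a = b * c"
      then have "a = \<rho> b * \<rho> c" using \<rho> by metis
      then have "sd_unit S (\<rho> b) \<or> sd_unit S (\<rho> c)"
        using a S.atom_factor \<rho>(1) bc by blast
      moreover have "sd_assoc T b (\<iota> (\<rho> b))" "sd_assoc T c (\<iota> (\<rho> c))"
        using divisor[of a b c] divisor[of a c b] bc that a S.atomD by (auto simp: mult.commute)
      ultimately show "sd_unit T b \<or> sd_unit T c"
        using unit unit_assoc \<rho>(1) bc by blast
    qed
  qed
  have \<iota>_prod: "\<iota> (prod_mset A) = prod_mset (image_mset \<iota> A)" for A
    by (induction A) (auto simp: \<iota>)
  have \<rho>_prod: "\<rho> (prod_mset A) = prod_mset (image_mset \<rho> A)" for A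
    by (induction A) (auto simp: \<rho>)
  have assoc: "sd_assoc T (\<iota> a) (\<iota> b) \<longleftrightarrow> sd_assoc S a b" if "a \<in> S" "b \<in> S" for a b
  proof
    assume "sd_assoc T (\<iota> a) (\<iota> b)"
    then obtain u v where "u \<in> T" "v \<in> T" "u * v = 1" "\<iota> a = u * \<iota> b"
      by (auto simp: sd_assoc_def sd_unit_def)
    then have "a = \<rho> u * b" "\<rho> u * \<rho> v = 1" "\<rho> u \<in> S" "\<rho> v \<in> S"
      using \<rho> by metis+
    then show "sd_assoc S a b" using that by (auto simp: sd_assoc_def sd_unit_def)
  next
    assume "sd_assoc S a b"
    then show "sd_assoc T (\<iota> a) (\<iota> b)"
      using that \<iota> unit S.unit_closed unfolding sd_assoc_def by metis
  qed
  have "\<exists>A. (\<forall>a\<in>#A. sd_atom S a) \<and> prod_mset A = c"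
    if c: "c \<in> S" "c \<noteq> 0" "\<not> sd_unit S c" for c
  proof -
    have "\<iota> c \<in> T - {0}" "\<not> sd_unit T (\<iota> c)"
      using c \<iota> \<iota>0 unit by auto
    then obtain A where A: "\<forall>a\<in>#A. sd_atom T a" "prod_mset A = \<iota> c"
      using LFS unfolding LFS_def sd_atomic_def by blast
    have "sd_atom S (\<rho> a)" if "a \<in># A" for a
    proof -
      have "sd_dvd T a (\<iota> c)"
        using dvd_prod_mset[of a A] A that atomD by auto
      then have "sd_assoc T a (\<iota> (\<rho> a))"
        using divisor c A that atomD by (auto simp: sd_dvd_def)
      then have "sd_atom T (\<iota> (\<rho> a))"
        using atom_assoc A that by blast
      then show ?thesis using atom \<rho>(1) A that atomD by blast
    qed
    then show ?thesis
      using A(2) \<rho>(4)[of c] \<rho>_prod[of A] by (intro exI[of _ "image_mset \<rho> A"]) auto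
  qed
  moreover have "size A \<noteq> size B"
    if AB: "\<forall>a\<in>#A. sd_atom S a" "\<forall>a\<in>#B. sd_atom S a" "sd_assoc S (prod_mset A) (prod_mset B)"
      and neq: "sd_factorization S A \<noteq> sd_factorization S B" for A B
  proof -
    have inS: "\<forall>a\<in>#A. a \<in> S" "\<forall>a\<in>#B. a \<in> S" using AB S.atomD by auto
    have "\<forall>a\<in>#image_mset \<iota> A. sd_atom T a" "\<forall>a\<in>#image_mset \<iota> B. sd_atom T a"
      using AB atom inS by auto
    moreover have "sd_assoc T (prod_mset (image_mset \<iota> A)) (prod_mset (image_mset \<iota> B))"
      using AB assoc S.prod_atoms_closed by (auto simp flip: \<iota>_prod)
    moreover have "sd_factorization T (image_mset \<iota> A) \<noteq> sd_factorization T (image_mset \<iota> B)"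
    proof
      assume "sd_factorization T (image_mset \<iota> A) = sd_factorization T (image_mset \<iota> B)"
      then have "rel_mset (\<lambda>a b. sd_assoc T (\<iota> a) (\<iota> b)) A B"
        using factorization_eq_iff_rel_mset[of "image_mset \<iota> A"] inS \<iota>
        by (simp add: multiset.rel_map)
      then have "rel_mset (sd_assoc S) A B"
        using assoc inS by (auto elim!: multiset.rel_mono_strong)
      then show False using neq S.factorization_eq_iff_rel_mset inS by blast
    qed
    ultimately show ?thesis
      using LFS unfolding LFS_def by (metis size_image_mset)
  qed
  ultimately show ?thesis unfolding LFS_def sd_atomic_def by blast
qed

end

locale subdomain = mult_submonoid +
  assumes add_closed [simp, intro]: "a \<in> T \<Longrightarrow> b \<in> T \<Longrightarrow> a + b \<in> T"
    and uminus_closed [simp, intro]: "a \<in> T \<Longrightarrow> - a \<in> T"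
begin

lemma zero_closed [simp, intro]: "0 \<in> T"
  using add_closed[OF one_closed uminus_closed[OF one_closed]] by simp

lemma diff_closed [simp, intro]: "a \<in> T \<Longrightarrow> b \<in> T \<Longrightarrow> a - b \<in> T"
  using add_closed[of a "- b"] by simp

text \<open>If the generating relation reads \<open>b * p = a * q\<close> with \<open>a\<close> and \<open>b\<close> atoms, then
  \<open>b * (p + q) = (a + b) * q\<close> is a relation in which \<open>b\<close> occurs only on the left.
  It is therefore a positive multiple of the generator, which forces \<open>a\<close> to divide \<open>a + b\<close>.\<close>
lemma UFS_if_LFS:
  assumes "LFS T"
  shows "UFS T"
proof (rule ccontr)
  assume "\<not> UFS T"
  with assms obtain A0 B0 where AB0: "atom_relation A0 B0"
      "sd_factorization T A0 \<noteq> sd_factorization T B0"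
    and gen0: "\<And>C D. atom_relation C D \<Longrightarrow> \<exists>k. exponent_diff C D = (\<lambda>c. k * exponent_diff A0 B0 c)"
    using LFS_relation_generator by blast
  obtain A B where AB: "atom_relation A B" "exponent_diff A B = exponent_diff A0 B0"
    and disj: "\<And>a b. a \<in># A \<Longrightarrow> b \<in># B \<Longrightarrow> \<not> sd_assoc T a b"
    using irredundant_relation[OF AB0(1)] by blast
  have neq: "sd_factorization T A \<noteq> sd_factorization T B"
    using AB(2) AB0(2) exponent_diff_eq_0_iff by metis
  have atoms: "\<forall>a\<in>#A. sd_atom T a" "\<forall>b\<in>#B. sd_atom T b"
    and prods: "sd_assoc T (prod_mset A) (prod_mset B)"
    using AB by (auto simp: atom_relation_def)
  have "A \<noteq> {#}"
    using neq prods prod_atoms_unit[OF atoms(2)] unit_assoc unit_one by fastforce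
  then obtain b A' where A: "A = add_mset b A'" by (meson multiset_cases)
  have "B \<noteq> {#}"
    using neq prods prod_atoms_unit[OF atoms(1)] unit_assoc unit_one by fastforce
  then obtain a B' where B: "B = add_mset a B'" by (meson multiset_cases)
  have ab: "sd_atom T a" "sd_atom T b" "\<not> sd_assoc T a b" "\<not> sd_assoc T b a"
    using atoms disj[of b a] assoc_sym by (auto simp: A B)
  define p q where "p = prod_mset A'" and "q = prod_mset B'"
  have pq: "p \<in> T" "q \<in> T" "q \<noteq> 0"
    using prod_atoms_closed prod_atoms_nonzero atoms by (auto simp: p_def q_def A B)
  obtain u where u: "sd_unit T u" "b * p = u * (a * q)"
    using prods by (auto simp: sd_assoc_def A B p_def q_def)
  \<comment> \<open>Absorbing the unit turns the association into the equation
    \<open>b * p = a' * q\<close>, to which \<open>b * q\<close> can be added.\<close>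
  define a' where "a' = u * a"
  have a': "a' \<in> T" "sd_assoc T a' a" "b * p = a' * q"
    using u ab atomD(1) unit_closed by (auto simp: a'_def sd_assoc_def)
  \<comment> \<open>Here subtraction in \<open>T\<close> is indispensable: a divisor of
    \<open>a' + b\<close> that divides one summand must divide the other, and the atoms
    \<open>a\<close> and \<open>b\<close> are not associated.\<close>
  have not_dvd: "\<not> sd_dvd T b (a' + b)" "\<not> sd_dvd T a (a' + b)"
  proof safe
    assume "sd_dvd T b (a' + b)"
    then obtain c where "c \<in> T" "a' + b = b * c" by (auto simp: sd_dvd_def)
    then have "a' = b * (c - 1)" "c - 1 \<in> T"
      by (auto simp: algebra_simps diff_eq_eq[symmetric])
    then have "sd_dvd T b a'" by (auto simp: sd_dvd_def)
    then show False
      using atom_dvd_atom[of b a] dvd_assoc_right a' ab by blast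
  next
    assume "sd_dvd T a (a' + b)"
    then obtain c where "c \<in> T" "a' + b = a * c" by (auto simp: sd_dvd_def)
    then have "b = a * (c - u)" "c - u \<in> T"
      using u unit_closed by (auto simp: algebra_simps a'_def)
    then have "sd_dvd T a b" by (auto simp: sd_dvd_def)
    then show False
      using atom_dvd_atom[of a b] ab by blast
  qed
  have "a' + b \<noteq> 0"
  proof
    assume "a' + b = 0"
    then have "a' + b = a * 0" by simp
    then show False using not_dvd unfolding sd_dvd_def by blast
  qed
  have eq: "b * (p + q) = (a' + b) * q"
    using a' by (simp add: algebra_simps)
  then have "p + q \<noteq> 0" using \<open>a' + b \<noteq> 0\<close> pq by auto
  have atomic: "sd_atomic T" using assms by (simp add: LFS_def)
  obtain Z1 where Z1: "\<forall>a\<in>#Z1. sd_atom T a" "sd_assoc T (a' + b) (prod_mset Z1)"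
    using atomic_factorization[OF atomic _ \<open>a' + b \<noteq> 0\<close>] a' ab atomD(1) by blast
  obtain Z2 where Z2: "\<forall>a\<in>#Z2. sd_atom T a" "sd_assoc T (p + q) (prod_mset Z2)"
    using atomic_factorization[OF atomic _ \<open>p + q \<noteq> 0\<close>] pq by blast
  have "sd_assoc T (b * prod_mset Z2) (b * (p + q))" "sd_assoc T ((a' + b) * q) (prod_mset Z1 * q)"
    using assoc_mult[OF assoc_refl assoc_sym[OF Z2(2)]] assoc_mult[OF Z1(2) assoc_refl] pq ab atomD(1)
    by auto
  then have "atom_relation (add_mset b Z2) (Z1 + B')"
    using Z1 Z2 ab atoms assoc_trans[of "b * prod_mset Z2" "b * (p + q)" "prod_mset Z1 * q"]
    unfolding eq by (auto simp: atom_relation_def B q_def)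
  then obtain k where k: "exponent_diff (add_mset b Z2) (Z1 + B') = (\<lambda>c. k * exponent_diff A B c)"
    using gen0 AB(2) by metis
  have inT: "\<forall>a\<in>#A. a \<in> T" "\<forall>a\<in>#B. a \<in> T" "\<forall>a\<in>#B'. a \<in> T" "\<forall>a\<in>#Z1. a \<in> T"
    using atoms Z1 atomD by (auto simp: A B)
  have no_Z1: "count (sd_factorization T Z1) (sd_class T c) = 0" if "\<not> sd_dvd T c (a' + b)" for c
  proof (rule ccontr)
    assume "count (sd_factorization T Z1) (sd_class T c) \<noteq> 0"
    then obtain z where z: "z \<in># Z1" "sd_assoc T z c"
      using count_factorization_pos_iff[OF inT(4)] by auto
    then have "sd_dvd T c (prod_mset Z1)"
      using dvd_prod_mset[of z Z1] inT dvd_assoc_left by blast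
    then show False
      using that dvd_assoc_right assoc_sym Z1 by blast
  qed
  have "count (sd_factorization T B) (sd_class T b) = 0" "count (sd_factorization T A) (sd_class T a) = 0"
    using count_factorization_pos_iff[OF inT(2), of b] count_factorization_pos_iff[OF inT(1), of a]
      disj[of b] disj[of _ a] assoc_sym by (auto simp: A B)
  moreover have "sd_class T a \<noteq> sd_class T b"
    using class_eq_iff ab atomD by blast
  ultimately have cb: "exponent_diff A B (sd_class T b) > 0"
      "exponent_diff (add_mset b Z2) (Z1 + B') (sd_class T b) > 0"
    and ca: "exponent_diff A B (sd_class T a) = - 1 - int (count (sd_factorization T B') (sd_class T a))"
      "exponent_diff (add_mset b Z2) (Z1 + B') (sd_class T a) \<ge>
         - int (count (sd_factorization T B') (sd_class T a))"
    using no_Z1[of b] no_Z1[of a] not_dvd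
    by (auto simp: exponent_diff_def sd_factorization_def A B)
  have "k > 0"
    using cb unfolding k by (simp add: zero_less_mult_iff)
  \<comment> \<open>Let \<open>m\<close> be the multiplicity of \<open>a\<close> in
    \<open>B'\<close>. The generator has exponent \<open>-1 - m\<close> at \<open>a\<close>, so a
    positive multiple has at most that; but the new relation has at least \<open>-m\<close>, because
    \<open>a\<close> does not occur in \<open>Z1\<close>.\<close>
  define y where "y = k * (1 + int (count (sd_factorization T B') (sd_class T a)))"
  have "y \<ge> 1 * (1 + int (count (sd_factorization T B') (sd_class T a)))"
    unfolding y_def using \<open>k > 0\<close> by (intro mult_right_mono) auto
  moreover have "exponent_diff (add_mset b Z2) (Z1 + B') (sd_class T a) = - y"
    unfolding k ca(1) y_def by (simp add: algebra_simps)
  ultimately show False using ca(2) by simp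
qed

end

section \<open>Polynomials over a semidomain\<close>

text \<open>\<open>D\<close> is an arbitrary set because \<open>poly_semidomain\<close> is later
  also applied to ideals, such as the multiples of a prime.\<close>

lemma pCons_mem_poly_semidomain [simp]:
  "pCons a f \<in> poly_semidomain D \<longleftrightarrow> a \<in> D \<and> f \<in> poly_semidomain D"
proof -
  have "(\<forall>n. coeff (pCons a f) n \<in> D) \<longleftrightarrow> coeff (pCons a f) 0 \<in> D \<and> (\<forall>n. coeff (pCons a f) (Suc n) \<in> D)"
    by (metis not0_implies_Suc)
  then show ?thesis by (simp add: poly_semidomain_def)
qed

lemma zero_mem_poly_semidomain [simp]: "0 \<in> poly_semidomain D \<longleftrightarrow> 0 \<in> D"
  by (simp add: poly_semidomain_def)

lemma coeff_mem_poly_semidomain: "f \<in> poly_semidomain D \<Longrightarrow> coeff f n \<in> D"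
  by (simp add: poly_semidomain_def)

lemma add_mem_poly_semidomain:
  assumes "\<And>a b. a \<in> D \<Longrightarrow> b \<in> D \<Longrightarrow> a + b \<in> D"
    and "f \<in> poly_semidomain D" "g \<in> poly_semidomain D"
  shows "f + g \<in> poly_semidomain D"
  using assms by (simp add: poly_semidomain_def)

lemma smult_mem_poly_semidomain:
  assumes "f \<in> poly_semidomain E" and "\<And>b. b \<in> E \<Longrightarrow> a * b \<in> D"
  shows "smult a f \<in> poly_semidomain D"
  using assms by (simp add: poly_semidomain_def)

lemma mult_mem_poly_semidomain:
  assumes S: "semidomain S" and "f \<in> poly_semidomain S" "g \<in> poly_semidomain S"
  shows "f * g \<in> poly_semidomain S"
  using assms(2)
proof (induction f)
  case 0
  then show ?case by simp
next
  case (pCons a f)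
  then show ?case
    using S assms(3) unfolding semidomain_def
    by (auto intro!: add_mem_poly_semidomain smult_mem_poly_semidomain)
qed

lemma mult_submonoid_if_semidomain: "semidomain S \<Longrightarrow> mult_submonoid S"
  by unfold_locales (auto simp: semidomain_def)

lemma mult_submonoid_poly: "semidomain S \<Longrightarrow> mult_submonoid (poly_semidomain S)"
  by unfold_locales (auto simp: mult_mem_poly_semidomain one_pCons, auto simp: semidomain_def)

lemma unit_poly_iff:
  assumes "semidomain S"
  shows "sd_unit (poly_semidomain S) f \<longleftrightarrow> (\<exists>u. sd_unit S u \<and> f = [:u:])"
proof
  have S0: "0 \<in> S" using assms by (simp add: semidomain_def)
  show "\<exists>u. sd_unit S u \<and> f = [:u:]" if "sd_unit (poly_semidomain S) f"
  proof -
    obtain g where fg: "f \<in> poly_semidomain S" "g \<in> poly_semidomain S" "f * g = 1"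
      using \<open>sd_unit (poly_semidomain S) f\<close> by (auto simp: sd_unit_def)
    then have "f dvd 1" "g dvd 1" by (metis dvd_triv_left, metis dvd_triv_right)
    then obtain u v where "f = [:u:]" "g = [:v:]"
      by (meson is_unit_poly_iff)
    then show ?thesis using fg by (auto simp: sd_unit_def one_pCons mult.commute)
  qed
  show "sd_unit (poly_semidomain S) f" if u: "\<exists>u. sd_unit S u \<and> f = [:u:]"
  proof -
    obtain u v where "u \<in> S" "v \<in> S" "u * v = 1" "f = [:u:]"
      using u by (auto simp: sd_unit_def)
    then show ?thesis
      using S0 unfolding sd_unit_def by (auto simp: one_pCons intro!: bexI[of _ "[:v:]"])
  qed
qed

lemma assoc_poly_degree:
  assumes "semidomain S" "sd_assoc (poly_semidomain S) f g"
  shows "degree f = degree g"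
proof -
  obtain w where w: "sd_unit (poly_semidomain S) w" "f = w * g"
    using assms(2) by (auto simp: sd_assoc_def)
  then obtain u where "sd_unit S u" "w = [:u:]"
    using unit_poly_iff[OF assms(1)] by blast
  with w show ?thesis by (auto simp: sd_unit_def)
qed

lemma LFS_if_LFS_poly:
  assumes S: "semidomain S" and LFS: "LFS (poly_semidomain S)"
  shows "LFS S"
proof -
  interpret P: mult_submonoid "poly_semidomain S" by (rule mult_submonoid_poly[OF S])
  have S0: "0 \<in> S" using S by (simp add: semidomain_def)
  show ?thesis
  \<comment> \<open>The leading coefficient is multiplicative and fixes constants; a divisor of a
    nonzero constant has degree 0 and so equals its leading coefficient.\<close>
  proof (rule P.LFS_retract[where \<iota> = "\<lambda>a. [:a:]" and \<rho> = lead_coeff])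
    show "mult_submonoid S" by (rule mult_submonoid_if_semidomain[OF S])
    show "LFS (poly_semidomain S)" by fact
    fix c f g
    assume c: "c \<noteq> 0" "f \<in> poly_semidomain S" "[:c:] = f * g"
    then have "f \<noteq> 0" "g \<noteq> 0" by auto
    then have "degree f = 0" using c degree_mult_eq[of f g] by (metis add_is_0 degree_pCons_0)
    then have "[:lead_coeff f:] = f" by (metis degree_0_id)
    then show "sd_assoc (poly_semidomain S) f [:lead_coeff f:]"
      using c P.assoc_refl by metis
  qed (auto simp: S0 lead_coeff_mult one_pCons coeff_mem_poly_semidomain)
qed

section \<open>Atoms of low degree and the element -1\<close>

lemma (in mult_submonoid) LFS_two_atoms:
  assumes "LFS T" "sd_atom T a" "sd_atom T b" "sd_atom T c" "sd_atom T d" "a * b = c * d"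
  shows "sd_assoc T a c \<or> sd_assoc T a d"
proof -
  have "sd_assoc T (prod_mset {#a, b#}) (prod_mset {#c, d#})"
    using assms by (auto simp: atomD(1))
  moreover have "\<forall>x\<in>#{#a, b#}. sd_atom T x" "\<forall>x\<in>#{#c, d#}. sd_atom T x" "size {#a, b#} = size {#c, d#}"
    using assms by auto
  ultimately have "sd_factorization T {#a, b#} = sd_factorization T {#c, d#}"
    using assms(1) unfolding LFS_def by blast
  then have "sd_class T a \<in># {#sd_class T c, sd_class T d#}"
    by (metis image_mset_add_mset image_mset_single sd_factorization_def union_single_eq_member)
  then show ?thesis
    using class_eq_iff assms atomD by auto
qed

text \<open>The leading coefficients \<open>u\<close> and \<open>v\<close> of two factors satisfy
  \<open>u * v = 1\<close>, so they are units of \<open>S\<close>, and scaling each factor by the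
  other coefficient makes both monic. Swapping the factors allows the degrees to be ordered.\<close>

lemma monic_atomI:
  assumes S: "semidomain S" and f: "f \<in> poly_semidomain S" "lead_coeff f = 1" "degree f > 0"
    and no_factor: "\<And>g h. g \<in> poly_semidomain S \<Longrightarrow> h \<in> poly_semidomain S \<Longrightarrow> f = g * h \<Longrightarrow>
      lead_coeff g = 1 \<Longrightarrow> lead_coeff h = 1 \<Longrightarrow> degree g > 0 \<Longrightarrow> degree g \<le> degree h \<Longrightarrow> False"
  shows "sd_atom (poly_semidomain S) f"
proof -
  interpret P: mult_submonoid "poly_semidomain S" by (rule mult_submonoid_poly[OF S])
  show ?thesis
  proof (rule P.atomI)
    show "f \<in> poly_semidomain S" "f \<noteq> 0" using f by auto
    show "\<not> sd_unit (poly_semidomain S) f"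
      using f unit_poly_iff[OF S] by auto
    fix g h assume gh: "g \<in> poly_semidomain S" "h \<in> poly_semidomain S" "f = g * h"
    define u v where "u = lead_coeff g" and "v = lead_coeff h"
    have uv: "u \<in> S" "v \<in> S" "u * v = 1"
      using gh f by (auto simp: coeff_mem_poly_semidomain u_def v_def lead_coeff_mult)
    then have units: "sd_unit S u" "sd_unit S v"
      by (auto simp: sd_unit_def mult.commute)
    have mems: "smult v g \<in> poly_semidomain S" "smult u h \<in> poly_semidomain S"
      using gh uv S by (auto intro!: smult_mem_poly_semidomain simp: semidomain_def)
    have nz: "u \<noteq> 0" "v \<noteq> 0" using uv by auto
    have "f = smult v g * smult u h" "f = smult u h * smult v g"
      using gh uv by (simp_all add: mult.commute)
    then have "degree g = 0 \<or> degree h = 0"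
      using no_factor[of "smult v g" "smult u h"] no_factor[of "smult u h" "smult v g"] mems uv nz
      by (force simp: u_def[symmetric] v_def[symmetric] mult.commute)
    then have "g = [:u:] \<or> h = [:v:]"
      using degree_0_id[of g] degree_0_id[of h] by (auto simp: u_def v_def)
    then show "sd_unit (poly_semidomain S) g \<or> sd_unit (poly_semidomain S) h"
      using units unit_poly_iff[OF S] by blast
  qed
qed

lemma monic_degree_1: "degree f = 1 \<Longrightarrow> lead_coeff f = 1 \<Longrightarrow> f = [:coeff f 0, 1:]"
  by (auto intro!: poly_eqI simp: coeff_pCons coeff_eq_0 split: nat.split)

lemma monic_degree_2: "degree f = 2 \<Longrightarrow> lead_coeff f = 1 \<Longrightarrow> f = [:coeff f 0, coeff f 1, 1:]"
  by (auto intro!: poly_eqI simp: coeff_pCons coeff_eq_0 numeral_2_eq_2 split: nat.split)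

text \<open>Comparing coefficients in a hypothetical monic factorization writes \<open>-1\<close> as
  a sum or product of coefficients of the factors, or as one of these coefficients, all of which lie
  in \<open>S\<close>.\<close>

lemma poly_atoms_without_minus_one:
  fixes S :: "'a::idom set"
  assumes S: "semidomain S" and m1: "- 1 \<notin> S"
  shows "sd_atom (poly_semidomain S) [:1, 1:]"
    and "sd_atom (poly_semidomain S) [:1, 0, 1, 0, 1:]"
    and "sd_atom (poly_semidomain S) [:1, 1, 1:]"
    and "sd_atom (poly_semidomain S) [:1, 0, 0, 1:]"
proof -
  have mem [simp]: "0 \<in> S" "1 \<in> S" "\<And>a b. a \<in> S \<Longrightarrow> b \<in> S \<Longrightarrow> a + b \<in> S"
    "\<And>a b. a \<in> S \<Longrightarrow> b \<in> S \<Longrightarrow> a * b \<in> S"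
    using S by (auto simp: semidomain_def)
  have linear: "\<exists>a\<in>S. g = [:a, 1:]"
    if "g \<in> poly_semidomain S" "lead_coeff g = 1" "degree g = 1" for g
    using that monic_degree_1 coeff_mem_poly_semidomain by blast
  have quadratic: "\<exists>a\<in>S. \<exists>b\<in>S. g = [:b, a, 1:]"
    if "g \<in> poly_semidomain S" "lead_coeff g = 1" "degree g = 2" for g
    using that monic_degree_2 coeff_mem_poly_semidomain by blast
  have deg: "degree f = degree g + degree h" if "f = g * h" "lead_coeff g = 1" "lead_coeff h = 1"
    for f g h :: "'a poly"
    using that degree_mult_eq[of g h] by (metis lead_coeff_1 leading_coeff_0_iff zero_neq_one)
  have mult_sum_one: "a * a = a - 1" if "a * b = 1" "a + b = 1" for a b :: 'a
  proof -
    have "a * (a + b) = a" using that by simp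
    then have "a * a + 1 = a" by (simp only: distrib_left that(1))
    then show ?thesis by (simp add: eq_diff_eq)
  qed
  \<comment> \<open>Such an \<open>a\<close> is a root of \<open>x^2 - x + 1\<close>, so
    \<open>a^3 = -1\<close>.\<close>
  have sixth: False if "a \<in> S" "a * a = a - 1" for a
  proof -
    have "a * (a * a) = a * (a - 1)" by (simp only: that(2))
    also have "\<dots> = a * a - a" by (simp add: algebra_simps)
    also have "\<dots> = - 1" by (simp add: that(2))
    finally have "a * (a * a) = - 1" .
    then show False using m1 mem(4) that(1) by metis
  qed
  show "sd_atom (poly_semidomain S) [:1, 1:]"
  proof (rule monic_atomI[OF S])
    fix g h :: "'a poly" assume gh: "[:1, 1:] = g * h" "lead_coeff g = 1" "lead_coeff h = 1"
      "0 < degree g" "degree g \<le> degree h"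
    show False using deg[OF gh(1-3)] gh(4,5) by simp
  qed auto
  show "sd_atom (poly_semidomain S) [:1, 1, 1:]"
  proof (rule monic_atomI[OF S])
    fix g h assume gh: "g \<in> poly_semidomain S" "h \<in> poly_semidomain S" "[:1, 1, 1:] = g * h"
      "lead_coeff g = 1" "lead_coeff h = 1" "0 < degree g" "degree g \<le> degree h"
    have "degree g = 1" "degree h = 1" using deg[OF gh(3-5)] gh(6,7) by auto
    then obtain a b where ab: "a \<in> S" "b \<in> S" "g = [:a, 1:]" "h = [:b, 1:]"
      using linear gh by metis
    then have "a * b = 1" "a + b = 1" using gh(3) by (auto simp: ac_simps)
    then have "a * a = a - 1" using mult_sum_one by blast
    then show False using sixth ab by blast
  qed auto
  show "sd_atom (poly_semidomain S) [:1, 0, 0, 1:]"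
  proof (rule monic_atomI[OF S])
    fix g h assume gh: "g \<in> poly_semidomain S" "h \<in> poly_semidomain S" "[:1, 0, 0, 1:] = g * h"
      "lead_coeff g = 1" "lead_coeff h = 1" "0 < degree g" "degree g \<le> degree h"
    have "degree g = 1" "degree h = 2" using deg[OF gh(3-5)] gh(6,7) by auto
    then obtain a b c where ab: "a \<in> S" "b \<in> S" "c \<in> S" "g = [:a, 1:]" "h = [:c, b, 1:]"
      using linear quadratic gh by metis
    then have *: "a * c = 1" "a * b + c = 0" "a + b = 0" using gh(3) by (auto simp: ac_simps)
    then have "b = - a" by (simp add: eq_neg_iff_add_eq_0 add.commute)
    then have "c = a * a" using * by simp
    \<comment> \<open>From \<open>a * c = 1\<close> and \<open>c = a * a\<close> follows
      \<open>a^3 = 1\<close>, and \<open>b = -a\<close> supplies the sign.\<close>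
    then have "b * (a * a) = - 1" using * \<open>b = - a\<close> by simp
    then show False using m1 mem(4) ab by metis
  qed auto
  show "sd_atom (poly_semidomain S) [:1, 0, 1, 0, 1:]"
  proof (rule monic_atomI[OF S])
    fix g h assume gh: "g \<in> poly_semidomain S" "h \<in> poly_semidomain S" "[:1, 0, 1, 0, 1:] = g * h"
      "lead_coeff g = 1" "lead_coeff h = 1" "0 < degree g" "degree g \<le> degree h"
    have "degree g = 1 \<or> degree g = 2 \<and> degree h = 2"
      using deg[OF gh(3-5)] gh(6,7) by auto
    then show False
    proof (elim disjE conjE)
      assume "degree g = 1"
      then obtain a where a: "a \<in> S" "g = [:a, 1:]" using linear gh by metis
      \<comment> \<open>Evaluating at the root \<open>-a\<close> avoids an unknown cubic cofactor;
        all powers of \<open>-a\<close> that occur are even, so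
        \<open>-1 = a^2 + a^4\<close>.\<close>
      then have "poly [:1, 0, 1, 0, 1:] (- a) = 0" unfolding gh(3) by simp
      then have "a * a + a * a * (a * a) = - 1"
        by (simp add: eq_neg_iff_add_eq_0 algebra_simps)
      then show False using m1 mem(3,4) a by metis
    next
      assume "degree g = 2" "degree h = 2"
      then obtain a b c d where ab: "a \<in> S" "b \<in> S" "c \<in> S" "d \<in> S"
          "g = [:b, a, 1:]" "h = [:d, c, 1:]"
        using quadratic gh by metis
      then have *: "b * d = 1" "b * c + a * d = 0" "b + (a * c + d) = 1" "a + c = 0"
        using gh(3) by (auto simp: ac_simps)
      then have c: "c = - a" by (simp add: eq_neg_iff_add_eq_0 add.commute)
      \<comment> \<open>With \<open>c = -a\<close>, this is the vanishing coefficient of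
        \<open>x\<close>. The case \<open>a = 0\<close> leads to a root of
        \<open>x^2 - x + 1\<close>; the case \<open>d = b\<close> gives \<open>b = 1\<close> and
        \<open>a^2 = 1\<close>, so \<open>a\<close> or \<open>c\<close> is
        \<open>-1\<close>.\<close>
      then have "a * (d - b) = 0" using * by (simp add: algebra_simps)
      then consider "a = 0" | "a \<noteq> 0" "d = b" by auto
      then show False
      proof cases
        case 1
        then have "b * b = b - 1" using * mult_sum_one[of b d] by simp
        then show False using sixth ab by blast
      next
        case 2
        then have "b = 1 \<or> b = - 1" using * by (simp add: square_eq_1_iff)
        then have "b = 1" using m1 ab by blast
        then have "a * a = 1" using * c 2 by (simp add: algebra_simps)
        then have "a = 1 \<or> a = - 1" by (simp add: square_eq_1_iff)
        then show False using c m1 ab by auto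
      qed
    qed
  qed auto
qed

lemma minus_one_if_LFS_poly:
  fixes S :: "'a::idom set"
  assumes S: "semidomain S" and LFS: "LFS (poly_semidomain S)"
  shows "- 1 \<in> S"
proof (rule ccontr)
  assume "- 1 \<notin> S"
  note atoms = poly_atoms_without_minus_one[OF S this]
  interpret P: mult_submonoid "poly_semidomain S" by (rule mult_submonoid_poly[OF S])
  have "sd_assoc (poly_semidomain S) [:1, 1:] [:1, 1, 1:] \<or>
      sd_assoc (poly_semidomain S) [:1, 1:] [:1, 0, 0, 1:]"
    by (rule P.LFS_two_atoms[OF LFS atoms]) simp
  then have "degree [:1, 1 :: 'a:] = degree [:1, 1, 1 :: 'a:] \<or>
      degree [:1, 1 :: 'a:] = degree [:1, 0, 0, 1 :: 'a:]"
    using assoc_poly_degree[OF S] by blast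
  then show False by simp
qed

section \<open>Gauss' lemma\<close>

context subdomain
begin

lemma semidomain: "semidomain T"
  by (auto simp: semidomain_def)

lemma subdomain_poly: "subdomain (poly_semidomain T)"
proof -
  interpret P: mult_submonoid "poly_semidomain T" by (rule mult_submonoid_poly[OF semidomain])
  show ?thesis
    by unfold_locales (auto intro: add_mem_poly_semidomain simp: poly_semidomain_def)
qed

interpretation P: subdomain "poly_semidomain T"
  by (rule subdomain_poly)

lemma const_mem_poly [simp]: "[:c:] \<in> poly_semidomain T \<longleftrightarrow> c \<in> T"
  by simp

lemma smult_mem_poly: "c \<in> T \<Longrightarrow> f \<in> poly_semidomain T \<Longrightarrow> smult c f \<in> poly_semidomain T"
  by (auto intro: smult_mem_poly_semidomain)

text \<open>The coefficientwise extension of a prime ideal is prime. If the constant coefficient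
  \<open>a\<close> of \<open>f\<close> lies in \<open>D\<close>, it can be stripped from
  \<open>f\<close>. Otherwise the constant coefficient of the product puts that of \<open>g\<close>
  into \<open>D\<close>, and \<open>g\<close> is stripped instead.\<close>

lemma prime_ideal_poly:
  assumes D: "0 \<in> D" "\<And>a b. a \<in> D \<Longrightarrow> b \<in> D \<Longrightarrow> a - b \<in> D" "\<And>a b. a \<in> D \<Longrightarrow> b \<in> T \<Longrightarrow> a * b \<in> D"
    and prime: "\<And>a b. a \<in> T \<Longrightarrow> b \<in> T \<Longrightarrow> a * b \<in> D \<Longrightarrow> a \<in> D \<or> b \<in> D"
    and fg: "f \<in> poly_semidomain T" "g \<in> poly_semidomain T" "f * g \<in> poly_semidomain D"
  shows "f \<in> poly_semidomain D \<or> g \<in> poly_semidomain D"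
proof -
  have diff: "p - q \<in> poly_semidomain D" if "p \<in> poly_semidomain D" "q \<in> poly_semidomain D" for p q
    using that D by (simp add: poly_semidomain_def)
  have smult: "smult a p \<in> poly_semidomain D" if "a \<in> D" "p \<in> poly_semidomain T" for a p
    using that D by (auto intro: smult_mem_poly_semidomain)
  show ?thesis
    using fg(1,3)
  proof (induction f)
    case 0
    then show ?case using D by simp
  next
    case (pCons a f)
    show ?case
    proof (cases "a \<in> D")
      case True
      have "pCons a f * g - smult a g \<in> poly_semidomain D"
        using diff smult True pCons.prems fg(2) by blast
      then have "f * g \<in> poly_semidomain D" by simp
      then show ?thesis using pCons True by auto
    next
      case False
      have "g \<in> poly_semidomain D" using fg(2) pCons.prems(2)
      proof (induction g)
        case 0
        then show ?case using D by simp
      next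
        case (pCons b g)
        have "a * b \<in> D"
          using coeff_mem_poly_semidomain[OF pCons.prems(2), of 0] by (simp add: mult.commute)
        then have "b \<in> D"
          using prime[of a b] False pCons.prems \<open>pCons a f \<in> poly_semidomain T\<close> by auto
        moreover have "pCons a f * pCons b g - smult b (pCons a f) \<in> poly_semidomain D"
          using diff smult \<open>b \<in> D\<close> pCons.prems \<open>pCons a f \<in> poly_semidomain T\<close> by blast
        then have "pCons 0 (pCons a f * g) \<in> poly_semidomain D"
          by (simp only: mult_pCons_right add_diff_cancel_left')
        then have "pCons a f * g \<in> poly_semidomain D" by simp
        ultimately show ?case using pCons by auto
      qed
      then show ?thesis by simp
    qed
  qed
qed

text \<open>Divisibility by a constant becomes membership of the coefficients in a principal ideal,
  the form to which \<open>prime_ideal_poly\<close> applies.\<close>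

lemma const_dvd_poly_iff:
  assumes "p \<noteq> 0"
  shows "sd_dvd (poly_semidomain T) [:p:] f \<longleftrightarrow> f \<in> poly_semidomain ((*) p ` T)"
proof
  show "f \<in> poly_semidomain ((*) p ` T)" if "sd_dvd (poly_semidomain T) [:p:] f"
    using that by (auto simp: sd_dvd_def poly_semidomain_def)
  show "sd_dvd (poly_semidomain T) [:p:] f" if "f \<in> poly_semidomain ((*) p ` T)"
    using that
  proof (induction f)
    case 0
    then show ?case by (auto simp: sd_dvd_def intro: bexI[of _ 0])
  next
    case (pCons a f)
    then obtain c g where "c \<in> T" "a = p * c" "g \<in> poly_semidomain T" "f = [:p:] * g"
      by (auto simp: sd_dvd_def)
    then show ?case by (auto simp: sd_dvd_def intro!: bexI[of _ "pCons c g"])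
  qed
qed

lemma prime_const_poly:
  assumes "sd_prime T p"
  shows "sd_prime (poly_semidomain T) [:p:]"
proof -
  have p: "p \<in> T" "p \<noteq> 0" "\<not> sd_unit T p"
    and prime: "\<And>a b. a \<in> T \<Longrightarrow> b \<in> T \<Longrightarrow> a * b \<in> (*) p ` T \<Longrightarrow> a \<in> (*) p ` T \<or> b \<in> (*) p ` T"
    using assms unfolding sd_prime_def sd_dvd_def by blast+
  have "\<not> sd_unit (poly_semidomain T) [:p:]"
    using p unit_poly_iff[OF semidomain] by auto
  moreover have "sd_dvd (poly_semidomain T) [:p:] f \<or> sd_dvd (poly_semidomain T) [:p:] g"
    if "f \<in> poly_semidomain T" "g \<in> poly_semidomain T" "sd_dvd (poly_semidomain T) [:p:] (f * g)" for f g
    unfolding const_dvd_poly_iff[OF p(2)]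
  proof (rule prime_ideal_poly)
    show "f * g \<in> poly_semidomain ((*) p ` T)"
      using that const_dvd_poly_iff[OF p(2)] by blast
    show "a - b \<in> (*) p ` T" if "a \<in> (*) p ` T" "b \<in> (*) p ` T" for a b
      using that by (auto simp flip: right_diff_distrib)
    show "a * b \<in> (*) p ` T" if "a \<in> (*) p ` T" "b \<in> T" for a b
      using that by (auto simp: mult.assoc)
  qed (use that prime in auto)
  ultimately show ?thesis
    using p by (auto simp: sd_prime_def)
qed

text \<open>The choice is harmless for nonzero elements of a UFS, where all factorizations have the
  same size; there it is an additive measure vanishing only on units.\<close>

definition factor_length :: "'a \<Rightarrow> nat" where
  "factor_length c = (SOME n. \<exists>A. (\<forall>a\<in>#A. sd_atom T a) \<and> sd_assoc T c (prod_mset A) \<and> n = size A)"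

text \<open>Content one, expressed through constant atoms instead of a gcd of the
  coefficients.\<close>

definition primitive_poly :: "'a poly \<Rightarrow> bool" where
  "primitive_poly f \<longleftrightarrow> f \<in> poly_semidomain T \<and>
     (\<forall>p. sd_atom T p \<longrightarrow> \<not> sd_dvd (poly_semidomain T) [:p:] f)"

section \<open>Factorization lengths, primitive polynomials and prime atoms\<close>

context
  assumes UFS: "UFS T"
begin

lemma factor_length_eq:
  assumes "\<forall>a\<in>#A. sd_atom T a" "sd_assoc T c (prod_mset A)"
  shows "factor_length c = size A"
  unfolding factor_length_def
proof (rule some_equality)
  show "\<exists>B. (\<forall>a\<in>#B. sd_atom T a) \<and> sd_assoc T c (prod_mset B) \<and> size A = size B"
    using assms by blast
  fix n assume "\<exists>B. (\<forall>a\<in>#B. sd_atom T a) \<and> sd_assoc T c (prod_mset B) \<and> n = size B"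
  then obtain B where B: "\<forall>a\<in>#B. sd_atom T a" "sd_assoc T c (prod_mset B)" "n = size B"
    by blast
  then have "sd_assoc T (prod_mset A) (prod_mset B)"
    using assms assoc_sym assoc_trans by blast
  then have "sd_factorization T A = sd_factorization T B"
    using UFS assms B unfolding UFS_def by blast
  then show "n = size A"
    using B unfolding sd_factorization_def by (metis size_image_mset)
qed

lemma factor_length_obtain:
  assumes "c \<in> T" "c \<noteq> 0"
  obtains A where "\<forall>a\<in>#A. sd_atom T a" "sd_assoc T c (prod_mset A)" "factor_length c = size A"
  using atomic_factorization[OF _ assms] factor_length_eq UFS unfolding UFS_def by metis

lemma factor_length_mult:
  assumes "a \<in> T" "b \<in> T" "a \<noteq> 0" "b \<noteq> 0"
  shows "factor_length (a * b) = factor_length a + factor_length b"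
proof -
  obtain A where A: "\<forall>a\<in>#A. sd_atom T a" "sd_assoc T a (prod_mset A)" "factor_length a = size A"
    using assms factor_length_obtain by blast
  obtain B where B: "\<forall>a\<in>#B. sd_atom T a" "sd_assoc T b (prod_mset B)" "factor_length b = size B"
    using assms factor_length_obtain by blast
  have "factor_length (a * b) = size (A + B)"
    using A B assoc_mult by (intro factor_length_eq) auto
  then show ?thesis using A B by simp
qed

lemma unit_if_factor_length_0:
  assumes "a \<in> T" "a \<noteq> 0" "factor_length a = 0"
  shows "sd_unit T a"
proof -
  obtain A where "sd_assoc T a (prod_mset A)" "factor_length a = size A"
    using assms factor_length_obtain by blast
  then show ?thesis using assms unit_assoc_one by auto
qed

lemma atomic_poly: "sd_atomic (poly_semidomain T)"
\<comment> \<open>Both summands are additive, since leading coefficients multiply; the measure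
  vanishes only on constants that are units.\<close>
proof (rule P.atomic_if_measure[where \<mu> = "\<lambda>f. degree f + factor_length (lead_coeff f)"])
  fix f g assume fg: "f \<in> poly_semidomain T" "g \<in> poly_semidomain T" "f \<noteq> 0" "g \<noteq> 0"
  then show "degree (f * g) + factor_length (lead_coeff (f * g)) =
      degree f + factor_length (lead_coeff f) + (degree g + factor_length (lead_coeff g))"
    using factor_length_mult[of "lead_coeff f" "lead_coeff g"]
    unfolding lead_coeff_mult by (simp add: degree_mult_eq coeff_mem_poly_semidomain)
next
  fix f assume f: "f \<in> poly_semidomain T" "f \<noteq> 0" "degree f + factor_length (lead_coeff f) = 0"
  then have "sd_unit T (lead_coeff f)"
    by (metis add_is_0 coeff_mem_poly_semidomain leading_coeff_0_iff unit_if_factor_length_0)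
  moreover have "f = [:lead_coeff f:]" using f by (metis add_is_0 degree_0_id)
  ultimately show "sd_unit (poly_semidomain T) f"
    using unit_poly_iff[OF semidomain] by blast
qed

text \<open>Each atom of \<open>c\<close> is a prime constant that does not divide \<open>f\<close>,
  so it divides \<open>q\<close> and cancels. This plays the role of Gauss' descent from the field
  of fractions: divisibility up to a nonzero constant is already divisibility.\<close>

lemma primitive_cancel_const:
  assumes f: "primitive_poly f" and c: "c \<in> T" "c \<noteq> 0"
    and qw: "q \<in> poly_semidomain T" "w \<in> poly_semidomain T" "f * q = smult c w"
  shows "sd_dvd (poly_semidomain T) f w"
proof -
  have cancel: "sd_dvd (poly_semidomain T) f w"
    if "\<forall>a\<in>#A. sd_atom T a" "q \<in> poly_semidomain T" "w \<in> poly_semidomain T"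
      "f * q = smult (prod_mset A) w" for A q w
    using that
  proof (induction A arbitrary: q)
    case empty
    then show ?case unfolding sd_dvd_def by (metis prod_mset_empty smult_1_left)
  next
    case (add p A)
    have p: "sd_atom T p" "p \<noteq> 0" using add.prems atomD by auto
    have "sd_dvd (poly_semidomain T) [:p:] (f * q)"
      unfolding sd_dvd_def using add.prems smult_mem_poly[OF prod_atoms_closed, of A]
      by (intro bexI[of _ "smult (prod_mset A) w"]) (auto simp: mult.commute)
    then have "sd_dvd (poly_semidomain T) [:p:] q"
      using prime_const_poly[OF UFS_atom_prime[OF UFS p(1)]] f p add.prems
      unfolding sd_prime_def primitive_poly_def by blast
    then obtain q' where q': "q' \<in> poly_semidomain T" "q = smult p q'"
      by (auto simp: sd_dvd_def)
    then have "smult p (f * q') = smult p (smult (prod_mset A) w)"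
      using add.prems by simp
    then have "f * q' = smult (prod_mset A) w"
      using p by (metis smult_cancel)
    then show ?case using add q' by auto
  qed
  obtain A where A: "\<forall>a\<in>#A. sd_atom T a" "sd_assoc T c (prod_mset A)"
    using factor_length_obtain c by blast
  then obtain u where u: "sd_unit T u" "c = u * prod_mset A"
    by (auto simp: sd_assoc_def)
  have *: "sd_dvd (poly_semidomain T) f (smult u w)"
    using qw u A unit_closed by (intro cancel[of A q]) (auto simp: smult_mem_poly mult.commute)
  then have "sd_assoc (poly_semidomain T) (smult u w) w"
    using u qw unit_poly_iff[OF semidomain] unit_closed smult_mem_poly
    unfolding sd_assoc_def by (metis mult_smult_left mult_1 smult_one)
  then show ?thesis using * P.dvd_assoc_right by blast
qed

text \<open>Constant atoms are pulled out one by one; each lowers the number of atoms of the leading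
  coefficient, so the process stops.\<close>

lemma primitive_part:
  assumes "d \<in> poly_semidomain T" "d \<noteq> 0"
  obtains e d' where "e \<in> T" "e \<noteq> 0" "primitive_poly d'" "d = smult e d'"
proof -
  have "\<exists>e\<in>T. \<exists>d'. e \<noteq> 0 \<and> primitive_poly d' \<and> d = smult e d'"
    using assms
  proof (induction "factor_length (lead_coeff d)" arbitrary: d rule: less_induct)
    case less
    show ?case
    proof (cases "primitive_poly d")
      case True
      then show ?thesis by (intro bexI[of _ 1] exI[of _ d]) auto
    next
      case False
      then obtain p d1 where p: "sd_atom T p" "d1 \<in> poly_semidomain T" "d = smult p d1"
        using less.prems by (auto simp: primitive_poly_def sd_dvd_def)
      have nz: "p \<noteq> 0" "d1 \<noteq> 0" "p \<in> T" using less.prems p atomD by auto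
      have "factor_length p \<noteq> 0"
        using unit_if_factor_length_0[of p] p atomD by blast
      then have "factor_length (lead_coeff d1) < factor_length (lead_coeff d)"
        using factor_length_mult[of p "lead_coeff d1"] p nz by (simp add: coeff_mem_poly_semidomain)
      then obtain e d' where "e \<in> T" "e \<noteq> 0" "primitive_poly d'" "d1 = smult e d'"
        using less.hyps p nz by blast
      then show ?thesis using p nz by (intro bexI[of _ "p * e"] exI[of _ d']) auto
    qed
  qed
  then show thesis using that by blast
qed

lemma primitive_if_nonconst_atom:
  assumes "sd_atom (poly_semidomain T) f" "degree f > 0"
  shows "primitive_poly f"
  unfolding primitive_poly_def
proof safe
  show "f \<in> poly_semidomain T" using assms P.atomD by blast
  fix p assume p: "sd_atom T p" "sd_dvd (poly_semidomain T) [:p:] f"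
  then obtain g where g: "g \<in> poly_semidomain T" "f = [:p:] * g" by (auto simp: sd_dvd_def)
  then have "sd_unit (poly_semidomain T) [:p:] \<or> sd_unit (poly_semidomain T) g"
    using assms p P.atom_factor atomD const_mem_poly by blast
  then show False
    using unit_poly_iff[OF semidomain] p g assms atomD by auto
qed

text \<open>Pseudo-division by \<open>d\<close>: scaling by its leading coefficient makes the
  leading terms cancel without inverses. The remainders stay in \<open>I\<close>, where no nonzero
  element has degree below that of \<open>d\<close>, so the process can only end at 0.\<close>

lemma const_multiple_of_min_degree:
  assumes I: "I \<subseteq> poly_semidomain T"
      "\<And>v w. v \<in> I \<Longrightarrow> w \<in> I \<Longrightarrow> v - w \<in> I" "\<And>v w. v \<in> I \<Longrightarrow> w \<in> poly_semidomain T \<Longrightarrow> w * v \<in> I"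
    and d: "d \<in> I" "d \<noteq> 0" "\<And>w. w \<in> I \<Longrightarrow> w \<noteq> 0 \<Longrightarrow> degree d \<le> degree w"
    and w: "w \<in> I"
  shows "\<exists>c\<in>T. \<exists>q\<in>poly_semidomain T. c \<noteq> 0 \<and> smult c w = d * q"
  using w
\<comment> \<open>Since \<open>degree 0 = 0\<close>, the successor is needed to place 0 strictly
  below the nonzero constants.\<close>
proof (induction "if w = 0 then 0 else Suc (degree w)" arbitrary: w rule: less_induct)
  case less
  show ?case
  proof (cases "w = 0")
    case True
    then show ?thesis by (intro bexI[of _ 1] bexI[of _ 0]) auto
  next
    case False
    define a b where "a = lead_coeff d" and "b = lead_coeff w"
    define m where "m = monom b (degree w - degree d)"
    have ab: "a \<in> T" "b \<in> T" "a \<noteq> 0" "b \<noteq> 0"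
      using d less.prems I False by (auto simp: a_def b_def coeff_mem_poly_semidomain)
    have m: "m \<in> poly_semidomain T"
      using ab by (auto simp: m_def poly_semidomain_def)
    define w' where "w' = smult a w - m * d"
    have "w' \<in> I"
      using I(2)[OF I(3)[OF less.prems, of "[:a:]"] I(3)[OF d(1) m]] ab by (simp add: w'_def)
    have le: "degree d \<le> degree w" using d less.prems False by blast
    have "degree (smult a w) = degree w" "degree (m * d) = degree w"
      using ab le d(2) by (auto simp: m_def degree_mult_eq monom_eq_0_iff degree_monom_eq)
    moreover have "coeff (m * d) (degree w) = coeff (smult a w) (degree w)"
      using le by (simp add: m_def coeff_monom_mult a_def b_def)
    ultimately have "w' = 0 \<or> degree w' < degree w"
      unfolding w'_def
      by (metis coeff_diff degree_diff_le eq_iff_diff_eq_0 le_refl leading_coeff_0_iff linorder_le_less_linear order_antisym)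
    then have "(if w' = 0 then 0 else Suc (degree w')) < (if w = 0 then 0 else Suc (degree w))"
      using False by auto
    then obtain c q where cq: "c \<in> T" "c \<noteq> 0" "q \<in> poly_semidomain T" "smult c w' = d * q"
      using less.hyps \<open>w' \<in> I\<close> by blast
    have "smult (c * a) w = smult c w' + smult c (m * d)"
      by (simp add: w'_def smult_diff_right)
    also have "\<dots> = d * (q + smult c m)"
      unfolding cq by (simp add: algebra_simps)
    finally have "smult (c * a) w = d * (q + smult c m)" .
    then show ?thesis
      using cq ab m smult_mem_poly by (intro bexI[of _ "c * a"] bexI[of _ "q + smult c m"]) auto
  qed
qed

text \<open>The primitive part of an element of minimal degree in the ideal generated by \<open>f\<close> and \<open>g\<close>
  divides both generators; this replaces the greatest common divisor over the field of fractions.\<close>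
lemma prime_if_nonconst_atom:
  assumes f: "sd_atom (poly_semidomain T) f" "degree f > 0"
  shows "sd_prime (poly_semidomain T) f"
proof -
  have fP: "f \<in> poly_semidomain T" "f \<noteq> 0" using f P.atomD by blast+
  have "sd_dvd (poly_semidomain T) f h"
    if gh: "g \<in> poly_semidomain T" "h \<in> poly_semidomain T" "sd_dvd (poly_semidomain T) f (g * h)"
      and not_dvd: "\<not> sd_dvd (poly_semidomain T) f g" for g h
  proof -
    define I where "I = {u * f + v * g | u v. u \<in> poly_semidomain T \<and> v \<in> poly_semidomain T}"
    have I_sub: "I \<subseteq> poly_semidomain T"
      using fP gh by (auto simp: I_def)
    have I_diff: "v - w \<in> I" if "v \<in> I" "w \<in> I" for v w
    proof -
      obtain v1 v2 w1 w2 where "v = v1 * f + v2 * g" "w = w1 * f + w2 * g"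
        "v1 \<in> poly_semidomain T" "v2 \<in> poly_semidomain T" "w1 \<in> poly_semidomain T" "w2 \<in> poly_semidomain T"
        using \<open>v \<in> I\<close> \<open>w \<in> I\<close> unfolding I_def by blast
      then have "v - w = (v1 - w1) * f + (v2 - w2) * g" "v1 - w1 \<in> poly_semidomain T" "v2 - w2 \<in> poly_semidomain T"
        by (auto simp: algebra_simps)
      then show ?thesis unfolding I_def by blast
    qed
    have I_mult: "w * v \<in> I" if "v \<in> I" "w \<in> poly_semidomain T" for v w
    proof -
      obtain v1 v2 where "v = v1 * f + v2 * g" "v1 \<in> poly_semidomain T" "v2 \<in> poly_semidomain T"
        using \<open>v \<in> I\<close> unfolding I_def by blast
      then have "w * v = (w * v1) * f + (w * v2) * g" "w * v1 \<in> poly_semidomain T" "w * v2 \<in> poly_semidomain T"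
        using that by (auto simp: algebra_simps)
      then show ?thesis unfolding I_def by blast
    qed
    have fI: "f \<in> I"
      unfolding I_def by (rule CollectI, rule exI[of _ 1], rule exI[of _ 0]) simp
    have gI: "g \<in> I"
      unfolding I_def by (rule CollectI, rule exI[of _ 0], rule exI[of _ 1]) simp
    obtain d where d: "d \<in> I" "d \<noteq> 0" "\<And>w. w \<in> I \<Longrightarrow> w \<noteq> 0 \<Longrightarrow> degree d \<le> degree w"
      using ex_has_least_nat[of "\<lambda>d. d \<in> I \<and> d \<noteq> 0" f degree] fI fP by blast
    obtain e d' where e: "e \<in> T" "e \<noteq> 0" "primitive_poly d'" "d = smult e d'"
      using primitive_part d I_sub by blast
    have d'P: "d' \<in> poly_semidomain T" using e by (simp add: primitive_poly_def)
    have d'_dvd: "sd_dvd (poly_semidomain T) d' w" if wI: "w \<in> I" for w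
    proof -
      obtain c q where cq: "c \<in> T" "c \<noteq> 0" "q \<in> poly_semidomain T" "smult c w = d * q"
        using const_multiple_of_min_degree[OF I_sub I_diff I_mult d wI] by blast
      then have "d' * smult e q = smult c w" using e by simp
      then show ?thesis
        using primitive_cancel_const[OF e(3) cq(1,2)] smult_mem_poly e(1) cq(3) wI I_sub by blast
    qed
    obtain f' where f': "f' \<in> poly_semidomain T" "f = d' * f'"
      using d'_dvd[OF fI] by (auto simp: sd_dvd_def)
    \<comment> \<open>If \<open>f'\<close> were a unit, \<open>f\<close> would be associated to
      \<open>d'\<close> and so divide \<open>g\<close>. As \<open>f\<close> is an atom,
      \<open>d'\<close> must be the unit, which makes \<open>d\<close> a constant.\<close>
    have "\<not> sd_unit (poly_semidomain T) f'"
    proof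
      assume "sd_unit (poly_semidomain T) f'"
      then have "sd_assoc (poly_semidomain T) f d'"
        using f' fP d'P unfolding sd_assoc_def by (metis mult.commute)
      then show False
        using d'_dvd[OF gI] P.dvd_assoc_left P.assoc_sym not_dvd by blast
    qed
    then have "sd_unit (poly_semidomain T) d'"
      using f f' d'P P.atom_factor by blast
    then obtain u where "sd_unit T u" "d' = [:u:]"
      using unit_poly_iff[OF semidomain] by blast
    then obtain c where c: "c \<in> T" "c \<noteq> 0" "d = [:c:]"
      using e unit_closed unit_nonzero by (intro that[of "e * u"]) auto
    \<comment> \<open>A Bezout identity with a constant on the left. Multiplied by \<open>h\<close>,
      it shows that \<open>f\<close> divides \<open>smult c h\<close>, and primitivity of
      \<open>f\<close> removes \<open>c\<close>.\<close>
    then obtain s t where st: "s \<in> poly_semidomain T" "t \<in> poly_semidomain T" "[:c:] = s * f + t * g"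
      using d unfolding I_def by blast
    obtain r where r: "r \<in> poly_semidomain T" "g * h = f * r"
      using gh by (auto simp: sd_dvd_def)
    have "smult c h = (s * f + t * g) * h" unfolding st(3)[symmetric] by simp
    also have "\<dots> = f * (s * h) + t * (g * h)" by (simp add: algebra_simps)
    also have "\<dots> = f * (s * h + t * r)" unfolding r(2) by (simp add: algebra_simps)
    finally have "f * (s * h + t * r) = smult c h" ..
    then show ?thesis
      using primitive_cancel_const[OF primitive_if_nonconst_atom[OF f] c(1,2), of "s * h + t * r" h] st r gh by auto
  qed
  then show ?thesis
    using fP P.atomD(3)[OF f(1)] unfolding sd_prime_def by blast
qed

lemma atom_poly_prime:
  assumes "sd_atom (poly_semidomain T) f"
  shows "sd_prime (poly_semidomain T) f"
proof (cases "degree f = 0")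
  case True
  then obtain c where c: "f = [:c:]" by (metis degree_0_id)
  have "sd_atom T c"
  proof (rule atomI)
    show "c \<in> T" "c \<noteq> 0" "\<not> sd_unit T c"
      using assms P.atomD unit_poly_iff[OF semidomain] c by fastforce+
    fix a b assume "a \<in> T" "b \<in> T" "c = a * b"
    then have "sd_unit (poly_semidomain T) [:a:] \<or> sd_unit (poly_semidomain T) [:b:]"
      using assms P.atom_factor[of "[:a:]" "[:b:]"] c by (simp add: mult.commute)
    then show "sd_unit T a \<or> sd_unit T b"
      using unit_poly_iff[OF semidomain] by auto
  qed
  then show ?thesis using c prime_const_poly UFS_atom_prime[OF UFS] by blast
next
  case False
  then show ?thesis using assms prime_if_nonconst_atom by blast
qed

end

end

section \<open>Laurent polynomials\<close>

text \<open>This is \<open>x^k * p\<close>. Requiring \<open>coeff p 0 \<noteq> 0\<close> makes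
  \<open>k\<close> and \<open>p\<close> unique and gives a normal form for nonzero Laurent
  polynomials.\<close>

definition shifted_poly :: "int \<Rightarrow> 'a::idom poly \<Rightarrow> 'a fls" where
  "shifted_poly k p = fls_shift (- k) (fps_to_fls (fps_of_poly p))"

lemma shifted_poly_nth:
  "fls_nth (shifted_poly k p) n = (if n < k then 0 else coeff p (nat (n - k)))"
  by (simp add: shifted_poly_def)

lemma shifted_poly_mult: "shifted_poly k p * shifted_poly m q = shifted_poly (k + m) (p * q)"
  unfolding shifted_poly_def
  by (simp add: fls_times_both_shifted_simp fps_of_poly_mult fls_times_fps_to_fls)

lemma shifted_poly_one [simp]: "shifted_poly 0 1 = 1"
  by (simp add: shifted_poly_def)

lemma coeff_shifted_poly: "coeff p n = fls_nth (shifted_poly k p) (k + int n)"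
  by (simp add: shifted_poly_nth)

lemma shifted_poly_0 [simp]: "shifted_poly k 0 = 0"
  by (intro fls_eqI) (simp add: shifted_poly_nth)

lemma shifted_poly_inject: "shifted_poly k p = shifted_poly k q \<Longrightarrow> p = q"
  by (intro poly_eqI) (simp add: coeff_shifted_poly[of _ _ k])

lemma shifted_poly_eq_0_iff [simp]: "shifted_poly k p = 0 \<longleftrightarrow> p = 0"
  using shifted_poly_inject[of k p 0] by auto

lemma fls_subdegree_shifted_poly:
  assumes "coeff p 0 \<noteq> 0"
  shows "fls_subdegree (shifted_poly k p) = k"
  using assms by (intro fls_subdegree_eqI) (auto simp: shifted_poly_nth)

lemma shifted_poly_eq_iff:
  assumes "coeff p 0 \<noteq> 0" "coeff q 0 \<noteq> 0"
  shows "shifted_poly k p = shifted_poly m q \<longleftrightarrow> k = m \<and> p = q"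
proof
  assume eq: "shifted_poly k p = shifted_poly m q"
  then have "k = m" using assms fls_subdegree_shifted_poly by metis
  moreover have "p = q"
    using eq \<open>k = m\<close> shifted_poly_inject by blast
  ultimately show "k = m \<and> p = q" ..
qed simp

lemma shifted_poly_mem:
  assumes "0 \<in> S" "p \<in> poly_semidomain S"
  shows "shifted_poly k p \<in> laurent_poly_semidomain S"
proof -
  have "{n. fls_nth (shifted_poly k p) n \<noteq> 0} \<subseteq> {k..k + int (degree p)}"
    by (auto simp: shifted_poly_nth split: if_splits dest!: le_degree)
  then have "finite {n. fls_nth (shifted_poly k p) n \<noteq> 0}"
    by (rule finite_subset) simp
  then show ?thesis
    using assms by (auto simp: laurent_poly_semidomain_def poly_semidomain_def shifted_poly_nth)
qed

lemma laurent_normal_form: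
  assumes "f \<in> laurent_poly_semidomain S" "f \<noteq> 0"
  obtains k p where "p \<in> poly_semidomain S" "coeff p 0 \<noteq> 0" "f = shifted_poly k p"
proof -
  define k where "k = fls_subdegree f"
  define p where "p = Abs_poly (\<lambda>n. fls_nth f (int n + k))"
  have "finite {n. fls_nth f n \<noteq> 0}"
    using assms by (simp add: laurent_poly_semidomain_def)
  then have "finite ((\<lambda>n. int n + k) -` {n. fls_nth f n \<noteq> 0})"
    by (rule finite_vimageI) (auto intro: injI)
  then have coeff: "coeff p n = fls_nth f (int n + k)" for n
    unfolding p_def by (subst Abs_poly_inverse) (auto simp: MOST_iff_cofinite vimage_def)
  show thesis
  proof (rule that)
    show "p \<in> poly_semidomain S"
      using assms by (simp add: poly_semidomain_def laurent_poly_semidomain_def coeff)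
    show "coeff p 0 \<noteq> 0"
      using assms by (simp add: coeff k_def)
    show "f = shifted_poly k p"
      by (intro fls_eqI) (auto simp: shifted_poly_nth coeff k_def)
  qed
qed

lemma mult_submonoid_laurent:
  assumes S: "semidomain S"
  shows "mult_submonoid (laurent_poly_semidomain S)"
proof
  interpret P: mult_submonoid "poly_semidomain S" by (rule mult_submonoid_poly[OF S])
  have S0: "0 \<in> S" using S by (simp add: semidomain_def)
  show "1 \<in> laurent_poly_semidomain S"
    using shifted_poly_mem[OF S0 P.one_closed, of 0] by simp
  fix f g assume fg: "f \<in> laurent_poly_semidomain S" "g \<in> laurent_poly_semidomain S"
  show "f * g \<in> laurent_poly_semidomain S"
  proof (cases "f = 0 \<or> g = 0")
    case True
    then show ?thesis using shifted_poly_mem[OF S0, of 0 0] S0 by auto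
  next
    case False
    then show ?thesis
      using laurent_normal_form[OF fg(1)] laurent_normal_form[OF fg(2)] shifted_poly_mem[OF S0]
        P.mult_closed shifted_poly_mult by metis
  qed
qed

section \<open>Transfer between polynomials and Laurent polynomials\<close>

context
  fixes S :: "'a::idom set"
  assumes S: "semidomain S"
begin

interpretation P: mult_submonoid "poly_semidomain S"
  by (rule mult_submonoid_poly[OF S])

interpretation L: mult_submonoid "laurent_poly_semidomain S"
  by (rule mult_submonoid_laurent[OF S])

lemma shifted_poly_closed: "p \<in> poly_semidomain S \<Longrightarrow> shifted_poly k p \<in> laurent_poly_semidomain S"
  using S shifted_poly_mem by (auto simp: semidomain_def)

text \<open>Constant coefficients multiply in a domain, so a product of normal forms is a normal
  form. By uniqueness, a Laurent factorization is a polynomial factorization together with a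
  splitting of the exponent.\<close>

lemma shifted_poly_factor:
  assumes "f \<in> laurent_poly_semidomain S" "g \<in> laurent_poly_semidomain S"
    and "shifted_poly k p = f * g" "coeff p 0 \<noteq> 0"
  obtains i j q r where "f = shifted_poly i q" "g = shifted_poly j r" "k = i + j" "p = q * r"
    "q \<in> poly_semidomain S" "r \<in> poly_semidomain S" "coeff q 0 \<noteq> 0" "coeff r 0 \<noteq> 0"
proof -
  have "p \<noteq> 0" using assms(4) by auto
  then have "f \<noteq> 0" "g \<noteq> 0" using assms(3) by auto
  obtain i q where q: "q \<in> poly_semidomain S" "coeff q 0 \<noteq> 0" "f = shifted_poly i q"
    using laurent_normal_form[OF assms(1) \<open>f \<noteq> 0\<close>] by blast
  obtain j r where r: "r \<in> poly_semidomain S" "coeff r 0 \<noteq> 0" "g = shifted_poly j r"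
    using laurent_normal_form[OF assms(2) \<open>g \<noteq> 0\<close>] by blast
  have "k = i + j \<and> p = q * r"
    using assms q r shifted_poly_eq_iff[of p "q * r" k "i + j"]
    by (simp add: shifted_poly_mult coeff_mult_0)
  then show thesis using that q r by blast
qed

lemma unit_shifted_poly_iff:
  assumes "p \<in> poly_semidomain S" "coeff p 0 \<noteq> 0"
  shows "sd_unit (laurent_poly_semidomain S) (shifted_poly k p) \<longleftrightarrow> sd_unit (poly_semidomain S) p"
proof
  assume "sd_unit (laurent_poly_semidomain S) (shifted_poly k p)"
  then obtain g where g: "g \<in> laurent_poly_semidomain S" "shifted_poly 0 1 = shifted_poly k p * g"
    by (auto simp: sd_unit_def)
  have "coeff (1 :: 'a poly) 0 \<noteq> 0" by simp
  then obtain i q r where "shifted_poly k p = shifted_poly i q" "1 = q * r"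
      "r \<in> poly_semidomain S" "coeff q 0 \<noteq> 0"
    using shifted_poly_factor[OF shifted_poly_closed[OF assms(1), of k] g] by metis
  then show "sd_unit (poly_semidomain S) p"
    using assms shifted_poly_eq_iff unfolding sd_unit_def by metis
next
  assume "sd_unit (poly_semidomain S) p"
  then obtain q where "q \<in> poly_semidomain S" "p * q = 1" by (auto simp: sd_unit_def)
  then have "shifted_poly k p * shifted_poly (- k) q = 1" by (simp add: shifted_poly_mult)
  then show "sd_unit (laurent_poly_semidomain S) (shifted_poly k p)"
    using \<open>q \<in> poly_semidomain S\<close> assms shifted_poly_closed unfolding sd_unit_def by blast
qed

text \<open>The condition on the constant coefficient keeps \<open>x\<close> away, which is an atom
  of \<open>S[x]\<close> but a Laurent unit.\<close>

lemma atom_shifted_poly_iff: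
  assumes "p \<in> poly_semidomain S" "coeff p 0 \<noteq> 0"
  shows "sd_atom (laurent_poly_semidomain S) (shifted_poly k p) \<longleftrightarrow> sd_atom (poly_semidomain S) p"
proof
  assume atom: "sd_atom (laurent_poly_semidomain S) (shifted_poly k p)"
  show "sd_atom (poly_semidomain S) p"
  proof (rule P.atomI)
    show "p \<in> poly_semidomain S" "p \<noteq> 0" using assms by auto
    show "\<not> sd_unit (poly_semidomain S) p"
      using L.atomD(3)[OF atom] unit_shifted_poly_iff[OF assms] by simp
    fix q r assume qr: "q \<in> poly_semidomain S" "r \<in> poly_semidomain S" "p = q * r"
    have nz: "coeff q 0 \<noteq> 0" "coeff r 0 \<noteq> 0" using qr assms by (auto simp: coeff_mult_0)
    have "shifted_poly k p = shifted_poly k q * shifted_poly 0 r"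
      using qr by (simp add: shifted_poly_mult)
    then show "sd_unit (poly_semidomain S) q \<or> sd_unit (poly_semidomain S) r"
      using atom L.atom_factor shifted_poly_closed unit_shifted_poly_iff qr nz by metis
  qed
next
  assume atom: "sd_atom (poly_semidomain S) p"
  show "sd_atom (laurent_poly_semidomain S) (shifted_poly k p)"
  proof (rule L.atomI)
    show "shifted_poly k p \<in> laurent_poly_semidomain S" "shifted_poly k p \<noteq> 0"
      using assms shifted_poly_closed by auto
    show "\<not> sd_unit (laurent_poly_semidomain S) (shifted_poly k p)"
      using P.atomD(3)[OF atom] unit_shifted_poly_iff[OF assms] by simp
    fix f g assume "f \<in> laurent_poly_semidomain S" "g \<in> laurent_poly_semidomain S"
      "shifted_poly k p = f * g"
    then obtain i j q r where "f = shifted_poly i q" "g = shifted_poly j r" "p = q * r"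
        "q \<in> poly_semidomain S" "r \<in> poly_semidomain S" "coeff q 0 \<noteq> 0" "coeff r 0 \<noteq> 0"
      using shifted_poly_factor[OF _ _ _ assms(2)] by metis
    then show "sd_unit (laurent_poly_semidomain S) f \<or> sd_unit (laurent_poly_semidomain S) g"
      using atom P.atom_factor unit_shifted_poly_iff by metis
  qed
qed

lemma assoc_shifted_polyD:
  assumes "sd_assoc (laurent_poly_semidomain S) (shifted_poly k p) (shifted_poly m q)"
    and "p \<in> poly_semidomain S" "coeff p 0 \<noteq> 0" "q \<in> poly_semidomain S" "coeff q 0 \<noteq> 0"
  shows "sd_assoc (poly_semidomain S) p q"
proof -
  obtain u where u: "sd_unit (laurent_poly_semidomain S) u" "shifted_poly k p = u * shifted_poly m q"
    using assms by (auto simp: sd_assoc_def)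
  obtain i j v r where v: "u = shifted_poly i v" "shifted_poly m q = shifted_poly j r" "p = v * r"
      "v \<in> poly_semidomain S" "coeff v 0 \<noteq> 0" "coeff r 0 \<noteq> 0"
    using shifted_poly_factor[OF L.unit_closed[OF u(1)] shifted_poly_closed[OF assms(4)] u(2) assms(3)]
    by metis
  then have "q = r" using shifted_poly_eq_iff assms by blast
  moreover have "sd_unit (poly_semidomain S) v" using u v unit_shifted_poly_iff by blast
  ultimately show ?thesis using v assms unfolding sd_assoc_def by blast
qed

lemma atomic_laurent:
  assumes "sd_atomic (poly_semidomain S)"
  shows "sd_atomic (laurent_poly_semidomain S)"
proof -
  have "\<exists>A. (\<forall>a\<in>#A. sd_atom (laurent_poly_semidomain S) a) \<and> prod_mset A = f"
    if f: "f \<in> laurent_poly_semidomain S" "f \<noteq> 0" "\<not> sd_unit (laurent_poly_semidomain S) f" for f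
  proof -
    obtain k p where p: "p \<in> poly_semidomain S" "coeff p 0 \<noteq> 0" "f = shifted_poly k p"
      using laurent_normal_form[OF f(1,2)] by blast
    then have "\<not> sd_unit (poly_semidomain S) p" "p \<noteq> 0"
      using f unit_shifted_poly_iff by auto
    then obtain A where A: "\<forall>a\<in>#A. sd_atom (poly_semidomain S) a" "prod_mset A = p"
      using assms p unfolding sd_atomic_def by blast
    then have "A \<noteq> {#}" using \<open>\<not> sd_unit (poly_semidomain S) p\<close> by auto
    \<comment> \<open>A nonunit has at least one atom, and this one absorbs the power
      \<open>x^k\<close>.\<close>
    then obtain a B where B: "A = add_mset a B" by (meson multiset_cases)
    have prod: "shifted_poly 0 (prod_mset C) = prod_mset (image_mset (shifted_poly 0) C)" for C :: "'a poly multiset"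
      by (induction C) (simp_all add: shifted_poly_mult[where k = 0 and m = 0, simplified, symmetric])
    have nz: "coeff b 0 \<noteq> 0" if bA: "b \<in># A" for b
    proof -
      obtain C where C: "A = add_mset b C" using bA by (metis insert_DiffM)
      have "p = b * prod_mset C"
        unfolding A(2)[symmetric] C by simp
      then have "coeff p 0 = coeff b 0 * coeff (prod_mset C) 0"
        by (simp only: coeff_mult_0)
      with p(2) show ?thesis by (metis mult_zero_left)
    qed
    have "f = prod_mset (add_mset (shifted_poly k a) (image_mset (shifted_poly 0) B))"
      using p A B by (simp add: shifted_poly_mult flip: prod)
    moreover have "\<forall>c\<in>#add_mset (shifted_poly k a) (image_mset (shifted_poly 0) B).
        sd_atom (laurent_poly_semidomain S) c"
      using A nz B P.atomD(1) atom_shifted_poly_iff by auto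
    ultimately show ?thesis by blast
  qed
  then show ?thesis unfolding sd_atomic_def by blast
qed

lemma atom_laurent_prime:
  assumes primes: "\<And>p. sd_atom (poly_semidomain S) p \<Longrightarrow> sd_prime (poly_semidomain S) p"
    and f: "sd_atom (laurent_poly_semidomain S) f"
  shows "sd_prime (laurent_poly_semidomain S) f"
proof -
  obtain k p where p: "p \<in> poly_semidomain S" "coeff p 0 \<noteq> 0" "f = shifted_poly k p"
    using laurent_normal_form[OF L.atomD(1,2)[OF f]] by blast
  have prime: "sd_prime (poly_semidomain S) p"
    using primes atom_shifted_poly_iff[OF p(1,2)] f p(3) by blast
  have dvd: "sd_dvd (laurent_poly_semidomain S) f (shifted_poly i q)"
    if pq: "sd_dvd (poly_semidomain S) p q" for i q
  proof -
    obtain r where "r \<in> poly_semidomain S" "q = p * r" using pq by (auto simp: sd_dvd_def)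
    then have "shifted_poly i q = f * shifted_poly (i - k) r" "shifted_poly (i - k) r \<in> laurent_poly_semidomain S"
      using p shifted_poly_closed by (auto simp: shifted_poly_mult)
    then show ?thesis unfolding sd_dvd_def by blast
  qed
  have zero: "sd_dvd (laurent_poly_semidomain S) f 0"
  proof -
    have "0 \<in> laurent_poly_semidomain S"
      using shifted_poly_closed[of 0 0] S by (simp add: semidomain_def)
    then show ?thesis unfolding sd_dvd_def by (metis mult_zero_right)
  qed
  have "sd_dvd (laurent_poly_semidomain S) f a \<or> sd_dvd (laurent_poly_semidomain S) f b"
    if ab: "a \<in> laurent_poly_semidomain S" "b \<in> laurent_poly_semidomain S"
      "sd_dvd (laurent_poly_semidomain S) f (a * b)" for a b
  proof (cases "a = 0 \<or> b = 0")
    case True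
    then show ?thesis using zero by auto
  next
    case False
    then obtain i j a' b' where a': "a' \<in> poly_semidomain S" "coeff a' 0 \<noteq> 0" "a = shifted_poly i a'"
        and b': "b' \<in> poly_semidomain S" "coeff b' 0 \<noteq> 0" "b = shifted_poly j b'"
      using laurent_normal_form[OF ab(1)] laurent_normal_form[OF ab(2)] by metis
    obtain c where c: "c \<in> laurent_poly_semidomain S" "shifted_poly (i + j) (a' * b') = f * c"
      using ab(3) a' b' by (auto simp: sd_dvd_def shifted_poly_mult)
    obtain i' q r where q: "f = shifted_poly i' q" "a' * b' = q * r" "r \<in> poly_semidomain S" "coeff q 0 \<noteq> 0"
      using shifted_poly_factor[OF L.atomD(1)[OF f] c] a' b' by (metis coeff_mult_0 mult_eq_0_iff)
    \<comment> \<open>Uniqueness of the normal form of \<open>f\<close> turns Laurent divisibility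
      into divisibility by \<open>p\<close> in \<open>S[x]\<close>.\<close>
    then have "q = p" using p shifted_poly_eq_iff by metis
    then have "sd_dvd (poly_semidomain S) p (a' * b')" using q by (auto simp: sd_dvd_def)
    then show ?thesis
      using prime a' b' dvd unfolding sd_prime_def by blast
  qed
  then show ?thesis
    using L.atomD[OF f] unfolding sd_prime_def by blast
qed

text \<open>The retraction is the lowest coefficient, because the coefficient at exponent 0 is not
  multiplicative on Laurent polynomials. A divisor of a nonzero constant is a monomial, associated
  to its coefficient since powers of \<open>x\<close> are units.\<close>

lemma LFS_if_LFS_laurent:
  assumes LFS: "LFS (laurent_poly_semidomain S)"
  shows "LFS S"
proof -
  have S0: "0 \<in> S" using S by (simp add: semidomain_def)
  have lowest: "fls_nth (shifted_poly k [:a:]) (fls_subdegree (shifted_poly k [:a:])) = a" for a :: 'a and k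
  proof (cases "a = 0")
    case False
    then show ?thesis by (simp add: fls_subdegree_shifted_poly shifted_poly_nth)
  qed simp
  show ?thesis
  proof (rule L.LFS_retract[where \<iota> = "\<lambda>a. shifted_poly 0 [:a:]" and \<rho> = "\<lambda>f. fls_nth f (fls_subdegree f)"])
    show "mult_submonoid S" by (rule mult_submonoid_if_semidomain[OF S])
    show "LFS (laurent_poly_semidomain S)" by fact
    show "shifted_poly 0 [:a:] \<in> laurent_poly_semidomain S" if "a \<in> S" for a
      using that S0 shifted_poly_closed by simp
    show "shifted_poly 0 [:1:] = (1 :: 'a fls)" by (simp flip: one_pCons)
    show "shifted_poly 0 [:a * b:] = shifted_poly 0 [:a:] * shifted_poly 0 [:b:]" for a b :: 'a
      by (simp add: shifted_poly_mult mult.commute)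
    show "fls_nth f (fls_subdegree f) \<in> S" if "f \<in> laurent_poly_semidomain S" for f
      using that by (simp add: laurent_poly_semidomain_def)
    show "fls_nth (f * g) (fls_subdegree (f * g)) =
        fls_nth f (fls_subdegree f) * fls_nth g (fls_subdegree g)" for f g :: "'a fls"
      by (cases "f = 0 \<or> g = 0") (auto simp: fls_times_base)
    show "fls_nth (shifted_poly 0 [:a:]) (fls_subdegree (shifted_poly 0 [:a:])) = a" for a :: 'a
      by (rule lowest)
    fix c f g
    assume c: "c \<noteq> 0" "f \<in> laurent_poly_semidomain S" "g \<in> laurent_poly_semidomain S"
      "shifted_poly 0 [:c:] = f * g"
    then obtain i q r where q: "f = shifted_poly i q" "[:c:] = q * r" "q \<in> poly_semidomain S"
      using shifted_poly_factor[OF c(2-4)] by (metis coeff_pCons_0)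
    then have "q \<noteq> 0" "r \<noteq> 0" using c by auto
    then have "degree q = 0" using q degree_mult_eq[of q r] by (metis add_is_0 degree_pCons_0)
    then obtain a where a: "q = [:a:]" by (metis degree_0_id)
    have "sd_unit (laurent_poly_semidomain S) (shifted_poly i 1)"
      using unit_shifted_poly_iff[of 1 i] by simp
    moreover have "f = shifted_poly i 1 * shifted_poly 0 [:a:]"
      using q a by (simp add: shifted_poly_mult)
    ultimately have "sd_assoc (laurent_poly_semidomain S) f (shifted_poly 0 [:a:])"
      using c(2) q(3) a shifted_poly_closed unfolding sd_assoc_def by blast
    then show "sd_assoc (laurent_poly_semidomain S) f (shifted_poly 0 [:fls_nth f (fls_subdegree f):])"
      using q a lowest by simp
  qed simp
qed

lemma minus_one_if_LFS_laurent:
  assumes LFS: "LFS (laurent_poly_semidomain S)"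
  shows "- 1 \<in> S"
proof (rule ccontr)
  assume "- 1 \<notin> S"
  note atoms = poly_atoms_without_minus_one[OF S this]
  \<comment> \<open>All four polynomials have constant coefficient 1, so they are in normal form and
    remain atoms; the shape \<open>pCons 1 p\<close> records this.\<close>
  have atomL: "sd_atom (laurent_poly_semidomain S) (shifted_poly 0 (pCons 1 p))"
    if "sd_atom (poly_semidomain S) (pCons 1 p)" for p
    using that atom_shifted_poly_iff P.atomD(1) by (metis coeff_pCons_0 zero_neq_one)
  have assocD: "degree (pCons 1 p) = degree (pCons 1 q)"
    if "sd_assoc (laurent_poly_semidomain S) (shifted_poly 0 (pCons 1 p)) (shifted_poly 0 (pCons 1 q))"
      "sd_atom (poly_semidomain S) (pCons 1 p)" "sd_atom (poly_semidomain S) (pCons 1 q)" for p q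
    using assoc_poly_degree[OF S assoc_shifted_polyD[OF that(1) P.atomD(1)[OF that(2)] _ P.atomD(1)[OF that(3)]]]
    by (simp only: coeff_pCons_0 one_neq_zero not_False_eq_True)
  have "sd_assoc (laurent_poly_semidomain S) (shifted_poly 0 [:1, 1:]) (shifted_poly 0 [:1, 1, 1:]) \<or>
      sd_assoc (laurent_poly_semidomain S) (shifted_poly 0 [:1, 1:]) (shifted_poly 0 [:1, 0, 0, 1:])"
    by (rule L.LFS_two_atoms[OF LFS atoms[THEN atomL]]) (simp add: shifted_poly_mult)
  then have "degree [:1, 1 :: 'a:] = degree [:1, 1, 1 :: 'a:] \<or>
      degree [:1, 1 :: 'a:] = degree [:1, 0, 0, 1 :: 'a:]"
    using assocD atoms by blast
  then show False by simp
qed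

end

text \<open>Negation is multiplication by \<open>-1\<close>, so being a domain is decided by this
  single element.\<close>

lemma subdomainI:
  assumes "semidomain S" "- 1 \<in> S"
  shows "subdomain S"
proof
  show "- a \<in> S" if "a \<in> S" for a
  proof -
    have "- 1 * a \<in> S" using assms that unfolding semidomain_def by blast
    then show ?thesis by simp
  qed
qed (use assms in \<open>auto simp: semidomain_def\<close>)

theorem theorem5p5:
  fixes S :: "'a::idom set"
  assumes "semidomain S"
  shows "(UFD S \<longleftrightarrow> UFS (poly_semidomain S))
       \<and> (UFS (poly_semidomain S) \<longleftrightarrow> UFS (laurent_poly_semidomain S))
       \<and> (UFS (laurent_poly_semidomain S) \<longleftrightarrow> LFD S)
       \<and> (LFD S \<longleftrightarrow> LFS (poly_semidomain S))
       \<and> (LFS (poly_semidomain S) \<longleftrightarrow> LFS (laurent_poly_semidomain S))"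
proof -
  interpret P: mult_submonoid "poly_semidomain S" by (rule mult_submonoid_poly[OF assms])
  interpret L: mult_submonoid "laurent_poly_semidomain S" by (rule mult_submonoid_laurent[OF assms])
  have LFD: "LFD S" if "- 1 \<in> S" "LFS S"
    using that subdomain.uminus_closed[OF subdomainI[OF assms that(1)]]
    by (simp add: LFD_def sd_is_domain_def)
  have UFD: "UFD S" if "LFD S"
  proof -
    have "- 1 \<in> S" "LFS S" using that assms by (auto simp: LFD_def sd_is_domain_def semidomain_def)
    then show ?thesis
      using subdomain.UFS_if_LFS[OF subdomainI[OF assms]] that by (simp add: LFD_def UFD_def)
  qed
  have "UFS (poly_semidomain S) \<and> UFS (laurent_poly_semidomain S)" if "UFD S"
  proof -
    have "- 1 \<in> S" and UFS: "UFS S"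
      using that assms by (auto simp: UFD_def sd_is_domain_def semidomain_def)
    then interpret subdomain S using subdomainI[OF assms] by blast
    show ?thesis
      using P.UFS_if_atoms_prime[OF atomic_poly[OF UFS] atom_poly_prime[OF UFS]]
        L.UFS_if_atoms_prime[OF atomic_laurent[OF assms atomic_poly[OF UFS]]
          atom_laurent_prime[OF assms atom_poly_prime[OF UFS]]]
      by blast
  qed
  moreover have "LFD S" if "LFS (poly_semidomain S)"
    using LFD minus_one_if_LFS_poly[OF assms that] LFS_if_LFS_poly[OF assms that] by blast
  moreover have "LFD S" if "LFS (laurent_poly_semidomain S)"
    using LFD minus_one_if_LFS_laurent[OF assms that] LFS_if_LFS_laurent[OF assms that] by blast
  moreover have "LFD S" if "UFD S"
    using that LFS_if_UFS by (auto simp: UFD_def LFD_def)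
  \<comment> \<open>The implications close up: a UFD gives both UFS properties, each gives its LFS
    property, each of these gives LFD, and LFD gives UFD.\<close>
  ultimately show ?thesis
    using UFD LFS_if_UFS[of "poly_semidomain S"] LFS_if_UFS[of "laurent_poly_semidomain S"] by blast
qed

end
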